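(* Let $\mathcal{B}$ be a bicategory and let $\mathcal{L}, \mathcal{R}\colon \mathcal{B}^{\mathrm{op}} \rightarrow \mathbf{Cat}$ be $\mathcal{B}$-indexed categories. Then the dependent optics $\mathbf{Optic}_{\mathcal{L},\mathcal{R}}$, with objects, morphisms, identities and composition as described in the context, form a category.
   Context: For a bicategory $\mathcal{B}$, $\mathcal{B}(A,B)$ denotes the category of 1-morphisms $A\to B$ and 2-morphisms between them; $\mathcal{B}^{\mathrm{op}}$ reverses 1-morphisms only. A $\mathcal{B}$-indexed category is a pseudofunctor $\mathcal{B}^{\mathrm{op}}\to\mathbf{Cat}$. Write $\mathcal{L}^A=\mathcal{L}(A)$, $\mathcal{R}^A=\mathcal{R}(A)$, and, for a 1-morphism $f\colon A\to B$, $f^{*}=\mathcal{L}(f)\colon\mathcal{L}^B\to\mathcal{L}^A$ and $f^{*'}=\mathcal{R}(f)\colon\mathcal{R}^B\to\mathcal{R}^A$. A 2-morphism $m\colon f\Rightarrow g$ gives natural transformations $\mathcal{L}(m)\colon f^*\Rightarrow g^*$ and $\mathcal{R}(m)\colon f^{*'}\Rightarrow g^{*'}$. The coherence isomorphisms of $\mathcal{L}$ are $\theta_A\colon\mathrm{Id}_{\mathcal{L}^A}\Rightarrow \mathrm{Id}_A^*$ and $\theta_{f,g}\colon f^*\circ g^*\Rightarrow (g\circ f)^*$; those of $\mathcal{R}$ are $\theta'_A$, $\theta'_{f,g}$, defined analogously. Dependent optics $\mathbf{Optic}_{\mathcal{L},\mathcal{R}}$: the objects are triplets $(X,X')^A$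 with $A\in\mathrm{Ob}(\mathcal{B})$, $X\in\mathrm{Ob}(\mathcal{L}^A)$, $X'\in\mathrm{Ob}(\mathcal{R}^A)$. The morphisms are $$\mathbf{Optic}_{\mathcal{L},\mathcal{R}}\big((X,X')^A,(Y,Y')^B\big)=\int^{f\in\mathcal{B}(A,B)}\mathcal{L}^A(X,f^*Y)\times\mathcal{R}^A(f^{*'}Y',X'),$$ where these coends in $\mathbf{Set}$ are assumed to exist. Explicitly, a morphism is an equivalence class $\langle l\,|\,r\rangle$ of pairs $l\colon X\to f^*Y$, $r\colon f^{*'}Y'\to X'$ (with $f\colon A\to B$ called the representative), under the equivalence relation generated by $(\mathcal{L}(m)_Y\circ l,\,r)\sim(l,\,r\circ\mathcal{R}(m)_{Y'})$ for $m\colon f\Rightarrow g$ in $\mathcal{B}(A,B)$, $l\colon X\to f^*Y$, $r\colon g^{*'}Y'\to X'$. Identities: $\mathrm{id}_{(X,X')^A}=\langle(\theta_A)_X\,|\,(\theta_A'^{-1})_{X'}\rangle$, with representative $\mathrm{Id}_A$. Composition: for $\langle l_1|r_1\rangle\colon(X,X')^A\to(Y,Y')^B$ with representative $f$ and $\langle l_2|r_2\rangle\colon(Y,Y')^B\to(Z,Z')^C$ with representative $g$, $$\langle l_2|r_2\rangle\circ\langle l_1|r_1\rangle=\big\langle(\theta_{f,g})_Z\circ f^*(l_2)\circ l_1\,\big|\,r_1\circ f^{*'}(r_2)\circ(\theta'^{-1}_{f,g})_{Z'}\big\rangle$$ with representative $g\circ f$. *)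

theory Defs
  imports Main
begin

section \<open>Categories, functors, natural transformations\<close>

record ('x, 'a) cat =
  Ob  :: "'x set"
  Arr :: "'a set"
  Dom :: "'a \<Rightarrow> 'x"
  Cod :: "'a \<Rightarrow> 'x"
  Idn :: "'x \<Rightarrow> 'a"
  Cmp :: "'a \<Rightarrow> 'a \<Rightarrow> 'a"  (infixr "\<cdot>\<index>" 70)

definition Hom :: "('x, 'a, 'e) cat_scheme \<Rightarrow> 'x \<Rightarrow> 'x \<Rightarrow> 'a set" where
  "Hom C x y = {a \<in> Arr C. Dom C a = x \<and> Cod C a = y}"

text \<open>\<open>g \<cdot> f\<close> means \<open>g\<close> after \<open>f\<close>; its value is irrelevant unless \<open>Cod f = Dom g\<close>.\<close>

locale category =
  fixes C :: "('x, 'a, 'e) cat_scheme" (structure)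
  assumes dom_ob: "a \<in> Arr C \<Longrightarrow> Dom C a \<in> Ob C"
    and cod_ob: "a \<in> Arr C \<Longrightarrow> Cod C a \<in> Ob C"
    and id_hom: "x \<in> Ob C \<Longrightarrow> Idn C x \<in> Hom C x x"
    and cmp_hom: "\<lbrakk>f \<in> Hom C x y; g \<in> Hom C y z\<rbrakk> \<Longrightarrow> g \<cdot> f \<in> Hom C x z"
    and id_left: "f \<in> Hom C x y \<Longrightarrow> Idn C y \<cdot> f = f"
    and id_right: "f \<in> Hom C x y \<Longrightarrow> f \<cdot> Idn C x = f"
    and cmp_assoc: "\<lbrakk>f \<in> Hom C w x; g \<in> Hom C x y; h \<in> Hom C y z\<rbrakk>
      \<Longrightarrow> (h \<cdot> g) \<cdot> f = h \<cdot> (g \<cdot> f)"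

definition inverse_arrows :: "('x, 'a, 'e) cat_scheme \<Rightarrow> 'a \<Rightarrow> 'a \<Rightarrow> bool" where
  "inverse_arrows C f g \<longleftrightarrow>
     f \<in> Hom C (Dom C f) (Cod C f) \<and> g \<in> Hom C (Cod C f) (Dom C f) \<and>
     g \<cdot>\<^bsub>C\<^esub> f = Idn C (Dom C f) \<and> f \<cdot>\<^bsub>C\<^esub> g = Idn C (Cod C f)"

definition is_iso :: "('x, 'a, 'e) cat_scheme \<Rightarrow> 'a \<Rightarrow> bool" where
  "is_iso C f \<longleftrightarrow> (\<exists>g. inverse_arrows C f g)"

definition inv_arr :: "('x, 'a, 'e) cat_scheme \<Rightarrow> 'a \<Rightarrow> 'a" where
  "inv_arr C f = (THE g. inverse_arrows C f g)"

definition prod_cat :: "('x, 'a) cat \<Rightarrow> ('y, 'b) cat \<Rightarrow> ('x \<times> 'y, 'a \<times> 'b) cat" where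
  "prod_cat C D =
    \<lparr>Ob = Ob C \<times> Ob D,
     Arr = Arr C \<times> Arr D,
     Dom = (\<lambda>(a, b). (Dom C a, Dom D b)),
     Cod = (\<lambda>(a, b). (Cod C a, Cod D b)),
     Idn = (\<lambda>(x, y). (Idn C x, Idn D y)),
     Cmp = (\<lambda>(a', b') (a, b). (a' \<cdot>\<^bsub>C\<^esub> a, b' \<cdot>\<^bsub>D\<^esub> b))\<rparr>"

record ('x, 'a, 'y, 'b) func =
  FOb  :: "'x \<Rightarrow> 'y"
  FArr :: "'a \<Rightarrow> 'b"

locale is_functor =
  fixes C :: "('x, 'a) cat" and D :: "('y, 'b) cat" and F :: "('x, 'a, 'y, 'b) func"
  assumes fun_ob: "x \<in> Ob C \<Longrightarrow> FOb F x \<in> Ob D"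
    and fun_hom: "a \<in> Hom C x y \<Longrightarrow> FArr F a \<in> Hom D (FOb F x) (FOb F y)"
    and fun_id: "x \<in> Ob C \<Longrightarrow> FArr F (Idn C x) = Idn D (FOb F x)"
    and fun_cmp: "\<lbrakk>a \<in> Hom C x y; b \<in> Hom C y z\<rbrakk>
      \<Longrightarrow> FArr F (b \<cdot>\<^bsub>C\<^esub> a) = FArr F b \<cdot>\<^bsub>D\<^esub> FArr F a"

definition id_func :: "('x, 'a, 'x, 'a) func" where
  "id_func = \<lparr>FOb = id, FArr = id\<rparr>"

definition cmp_func ::
  "('y, 'b, 'z, 'c) func \<Rightarrow> ('x, 'a, 'y, 'b) func \<Rightarrow> ('x, 'a, 'z, 'c) func" where
  "cmp_func G F = \<lparr>FOb = FOb G \<circ> FOb F, FArr = FArr G \<circ> FArr F\<rparr>"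

text \<open>Natural transformations are given by their components at the objects of \<open>C\<close>.\<close>

locale nat_trans =
  fixes C :: "('x, 'a) cat" and D :: "('y, 'b) cat"
    and F G :: "('x, 'a, 'y, 'b) func" and t :: "'x \<Rightarrow> 'b"
  assumes component: "x \<in> Ob C \<Longrightarrow> t x \<in> Hom D (FOb F x) (FOb G x)"
    and naturality: "a \<in> Hom C x y \<Longrightarrow> t y \<cdot>\<^bsub>D\<^esub> FArr F a = FArr G a \<cdot>\<^bsub>D\<^esub> t x"

locale nat_iso = nat_trans +
  assumes component_iso: "x \<in> Ob C \<Longrightarrow> is_iso D (t x)"


section \<open>Bicategories\<close>

text \<open>
  \<open>HC A B\<close> is the category of 1-cells \<open>A \<rightarrow> B\<close> and 2-cells between them, and
  \<open>HCmp A B C\<close> is horizontal composition \<open>HC B C \<times> HC A B \<rightarrow> HC A C\<close>.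
  Different hom-categories may share elements, which is why the structure maps are
  indexed by objects.  The directions of the structural 2-cells are
  \<open>Assoc A B C D h g f : (h \<circ> g) \<circ> f \<Rightarrow> h \<circ> (g \<circ> f)\<close>,
  \<open>LUnit A B f : Id_B \<circ> f \<Rightarrow> f\<close> and \<open>RUnit A B f : f \<circ> Id_A \<Rightarrow> f\<close>.
\<close>

record ('o, 'm, 'c) bicat =
  Ob0   :: "'o set"
  HC    :: "'o \<Rightarrow> 'o \<Rightarrow> ('m, 'c) cat"
  Id1   :: "'o \<Rightarrow> 'm"
  HCmp  :: "'o \<Rightarrow> 'o \<Rightarrow> 'o \<Rightarrow> ('m \<times> 'm, 'c \<times> 'c, 'm, 'c) func"
  Assoc :: "'o \<Rightarrow> 'o \<Rightarrow> 'o \<Rightarrow> 'o \<Rightarrow> 'm \<Rightarrow> 'm \<Rightarrow> 'm \<Rightarrow> 'c"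
  LUnit :: "'o \<Rightarrow> 'o \<Rightarrow> 'm \<Rightarrow> 'c"
  RUnit :: "'o \<Rightarrow> 'o \<Rightarrow> 'm \<Rightarrow> 'c"

abbreviation cmp1 :: "('o, 'm, 'c) bicat \<Rightarrow> 'o \<Rightarrow> 'o \<Rightarrow> 'o \<Rightarrow> 'm \<Rightarrow> 'm \<Rightarrow> 'm" where
  "cmp1 \<B> A B C g f \<equiv> FOb (HCmp \<B> A B C) (g, f)"

abbreviation cmp2 :: "('o, 'm, 'c) bicat \<Rightarrow> 'o \<Rightarrow> 'o \<Rightarrow> 'o \<Rightarrow> 'c \<Rightarrow> 'c \<Rightarrow> 'c" where
  "cmp2 \<B> A B C b a \<equiv> FArr (HCmp \<B> A B C) (b, a)"

locale bicategory =
  fixes \<B> :: "('o, 'm, 'c) bicat"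
  assumes hom_category:
      "\<lbrakk>A \<in> Ob0 \<B>; B \<in> Ob0 \<B>\<rbrakk> \<Longrightarrow> category (HC \<B> A B)"
    and id1_ob:
      "A \<in> Ob0 \<B> \<Longrightarrow> Id1 \<B> A \<in> Ob (HC \<B> A A)"
    and hcmp_functor:
      "\<lbrakk>A \<in> Ob0 \<B>; B \<in> Ob0 \<B>; C \<in> Ob0 \<B>\<rbrakk>
       \<Longrightarrow> is_functor (prod_cat (HC \<B> B C) (HC \<B> A B)) (HC \<B> A C) (HCmp \<B> A B C)"
    and assoc_hom:
      "\<lbrakk>A \<in> Ob0 \<B>; B \<in> Ob0 \<B>; C \<in> Ob0 \<B>; D \<in> Ob0 \<B>;
        f \<in> Ob (HC \<B> A B); g \<in> Ob (HC \<B> B C); h \<in> Ob (HC \<B> C D)\<rbrakk>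
       \<Longrightarrow> Assoc \<B> A B C D h g f
            \<in> Hom (HC \<B> A D) (cmp1 \<B> A B D (cmp1 \<B> B C D h g) f)
                              (cmp1 \<B> A C D h (cmp1 \<B> A B C g f))"
    and assoc_iso:
      "\<lbrakk>A \<in> Ob0 \<B>; B \<in> Ob0 \<B>; C \<in> Ob0 \<B>; D \<in> Ob0 \<B>;
        f \<in> Ob (HC \<B> A B); g \<in> Ob (HC \<B> B C); h \<in> Ob (HC \<B> C D)\<rbrakk>
       \<Longrightarrow> is_iso (HC \<B> A D) (Assoc \<B> A B C D h g f)"
    and assoc_natural:
      "\<lbrakk>A \<in> Ob0 \<B>; B \<in> Ob0 \<B>; C \<in> Ob0 \<B>; D \<in> Ob0 \<B>;
        a \<in> Hom (HC \<B> A B) f f'; b \<in> Hom (HC \<B> B C) g g'; c \<in> Hom (HC \<B> C D) h h'\<rbrakk>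
       \<Longrightarrow> Assoc \<B> A B C D h' g' f' \<cdot>\<^bsub>HC \<B> A D\<^esub> cmp2 \<B> A B D (cmp2 \<B> B C D c b) a
          = cmp2 \<B> A C D c (cmp2 \<B> A B C b a) \<cdot>\<^bsub>HC \<B> A D\<^esub> Assoc \<B> A B C D h g f"
    and lunit_hom:
      "\<lbrakk>A \<in> Ob0 \<B>; B \<in> Ob0 \<B>; f \<in> Ob (HC \<B> A B)\<rbrakk>
       \<Longrightarrow> LUnit \<B> A B f \<in> Hom (HC \<B> A B) (cmp1 \<B> A B B (Id1 \<B> B) f) f"
    and lunit_iso:
      "\<lbrakk>A \<in> Ob0 \<B>; B \<in> Ob0 \<B>; f \<in> Ob (HC \<B> A B)\<rbrakk>
       \<Longrightarrow> is_iso (HC \<B> A B) (LUnit \<B> A B f)"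
    and lunit_natural:
      "\<lbrakk>A \<in> Ob0 \<B>; B \<in> Ob0 \<B>; a \<in> Hom (HC \<B> A B) f f'\<rbrakk>
       \<Longrightarrow> LUnit \<B> A B f' \<cdot>\<^bsub>HC \<B> A B\<^esub> cmp2 \<B> A B B (Idn (HC \<B> B B) (Id1 \<B> B)) a
          = a \<cdot>\<^bsub>HC \<B> A B\<^esub> LUnit \<B> A B f"
    and runit_hom:
      "\<lbrakk>A \<in> Ob0 \<B>; B \<in> Ob0 \<B>; f \<in> Ob (HC \<B> A B)\<rbrakk>
       \<Longrightarrow> RUnit \<B> A B f \<in> Hom (HC \<B> A B) (cmp1 \<B> A A B f (Id1 \<B> A)) f"
    and runit_iso:
      "\<lbrakk>A \<in> Ob0 \<B>; B \<in> Ob0 \<B>; f \<in> Ob (HC \<B> A B)\<rbrakk>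
       \<Longrightarrow> is_iso (HC \<B> A B) (RUnit \<B> A B f)"
    and runit_natural:
      "\<lbrakk>A \<in> Ob0 \<B>; B \<in> Ob0 \<B>; a \<in> Hom (HC \<B> A B) f f'\<rbrakk>
       \<Longrightarrow> RUnit \<B> A B f' \<cdot>\<^bsub>HC \<B> A B\<^esub> cmp2 \<B> A A B a (Idn (HC \<B> A A) (Id1 \<B> A))
          = a \<cdot>\<^bsub>HC \<B> A B\<^esub> RUnit \<B> A B f"
    and pentagon:
      "\<lbrakk>A \<in> Ob0 \<B>; B \<in> Ob0 \<B>; C \<in> Ob0 \<B>; D \<in> Ob0 \<B>; E \<in> Ob0 \<B>;
        f \<in> Ob (HC \<B> A B); g \<in> Ob (HC \<B> B C); h \<in> Ob (HC \<B> C D); k \<in> Ob (HC \<B> D E)\<rbrakk>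
       \<Longrightarrow> Assoc \<B> A C D E k h (cmp1 \<B> A B C g f)
            \<cdot>\<^bsub>HC \<B> A E\<^esub> Assoc \<B> A B C E (cmp1 \<B> C D E k h) g f
          = cmp2 \<B> A D E (Idn (HC \<B> D E) k) (Assoc \<B> A B C D h g f)
            \<cdot>\<^bsub>HC \<B> A E\<^esub> Assoc \<B> A B D E k (cmp1 \<B> B C D h g) f
            \<cdot>\<^bsub>HC \<B> A E\<^esub> cmp2 \<B> A B E (Assoc \<B> B C D E k h g) (Idn (HC \<B> A B) f)"
    and triangle:
      "\<lbrakk>A \<in> Ob0 \<B>; B \<in> Ob0 \<B>; C \<in> Ob0 \<B>; f \<in> Ob (HC \<B> A B); g \<in> Ob (HC \<B> B C)\<rbrakk>
       \<Longrightarrow> cmp2 \<B> A B C (Idn (HC \<B> B C) g) (LUnit \<B> A B f)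
            \<cdot>\<^bsub>HC \<B> A C\<^esub> Assoc \<B> A B B C g (Id1 \<B> B) f
          = cmp2 \<B> A B C (RUnit \<B> B C g) (Idn (HC \<B> A B) f)"

text \<open>The dual reverses 1-cells only, so its associator is the inverse of the given one.\<close>

definition op_bicat :: "('o, 'm, 'c) bicat \<Rightarrow> ('o, 'm, 'c) bicat" where
  "op_bicat \<B> =
    \<lparr>Ob0 = Ob0 \<B>,
     HC = (\<lambda>A B. HC \<B> B A),
     Id1 = Id1 \<B>,
     HCmp = (\<lambda>A B C. \<lparr>FOb = (\<lambda>(g, f). cmp1 \<B> C B A f g),
                        FArr = (\<lambda>(b, a). cmp2 \<B> C B A a b)\<rparr>),
     Assoc = (\<lambda>A B C D h g f. inv_arr (HC \<B> D A) (Assoc \<B> D C B A f g h)),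
     LUnit = (\<lambda>A B f. RUnit \<B> B A f),
     RUnit = (\<lambda>A B f. LUnit \<B> B A f)\<rparr>"


section \<open>Pseudofunctors into \<open>Cat\<close> and indexed categories\<close>

text \<open>
  For \<open>f : A \<rightarrow> B\<close> and \<open>g : B \<rightarrow> C\<close>, \<open>PUnit P A\<close> has components
  \<open>X \<rightarrow> P(Id_A) X\<close> and \<open>PComp P A B C g f\<close> has components
  \<open>P(g) (P(f) X) \<rightarrow> P(g \<circ> f) X\<close>.
\<close>

record ('o, 'm, 'c, 'x, 'a) psfun =
  PCat  :: "'o \<Rightarrow> ('x, 'a) cat"
  PFun  :: "'o \<Rightarrow> 'o \<Rightarrow> 'm \<Rightarrow> ('x, 'a, 'x, 'a) func"
  PNat  :: "'o \<Rightarrow> 'o \<Rightarrow> 'c \<Rightarrow> 'x \<Rightarrow> 'a"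
  PUnit :: "'o \<Rightarrow> 'x \<Rightarrow> 'a"
  PComp :: "'o \<Rightarrow> 'o \<Rightarrow> 'o \<Rightarrow> 'm \<Rightarrow> 'm \<Rightarrow> 'x \<Rightarrow> 'a"

locale pseudofunctor_Cat =
  fixes \<K> :: "('o, 'm, 'c) bicat" and P :: "('o, 'm, 'c, 'x, 'a) psfun"
  assumes p_category:
      "A \<in> Ob0 \<K> \<Longrightarrow> category (PCat P A)"
    and p_functor:
      "\<lbrakk>A \<in> Ob0 \<K>; B \<in> Ob0 \<K>; f \<in> Ob (HC \<K> A B)\<rbrakk>
       \<Longrightarrow> is_functor (PCat P A) (PCat P B) (PFun P A B f)"
    and p_nat_trans:
      "\<lbrakk>A \<in> Ob0 \<K>; B \<in> Ob0 \<K>; a \<in> Hom (HC \<K> A B) f f'\<rbrakk>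
       \<Longrightarrow> nat_trans (PCat P A) (PCat P B) (PFun P A B f) (PFun P A B f') (PNat P A B a)"
    and p_id2:
      "\<lbrakk>A \<in> Ob0 \<K>; B \<in> Ob0 \<K>; f \<in> Ob (HC \<K> A B); X \<in> Ob (PCat P A)\<rbrakk>
       \<Longrightarrow> PNat P A B (Idn (HC \<K> A B) f) X = Idn (PCat P B) (FOb (PFun P A B f) X)"
    and p_vcmp:
      "\<lbrakk>A \<in> Ob0 \<K>; B \<in> Ob0 \<K>; a \<in> Hom (HC \<K> A B) f f'; a' \<in> Hom (HC \<K> A B) f' f'';
        X \<in> Ob (PCat P A)\<rbrakk>
       \<Longrightarrow> PNat P A B (a' \<cdot>\<^bsub>HC \<K> A B\<^esub> a) X = PNat P A B a' X \<cdot>\<^bsub>PCat P B\<^esub> PNat P A B a X"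
    and p_unit_iso:
      "A \<in> Ob0 \<K>
       \<Longrightarrow> nat_iso (PCat P A) (PCat P A) id_func (PFun P A A (Id1 \<K> A)) (PUnit P A)"
    and p_comp_iso:
      "\<lbrakk>A \<in> Ob0 \<K>; B \<in> Ob0 \<K>; C \<in> Ob0 \<K>; f \<in> Ob (HC \<K> A B); g \<in> Ob (HC \<K> B C)\<rbrakk>
       \<Longrightarrow> nat_iso (PCat P A) (PCat P C) (cmp_func (PFun P B C g) (PFun P A B f))
             (PFun P A C (cmp1 \<K> A B C g f)) (PComp P A B C g f)"
    and p_comp_natural:
      "\<lbrakk>A \<in> Ob0 \<K>; B \<in> Ob0 \<K>; C \<in> Ob0 \<K>;
        a \<in> Hom (HC \<K> A B) f f'; b \<in> Hom (HC \<K> B C) g g'; X \<in> Ob (PCat P A)\<rbrakk>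
       \<Longrightarrow> PNat P A C (cmp2 \<K> A B C b a) X \<cdot>\<^bsub>PCat P C\<^esub> PComp P A B C g f X
          = PComp P A B C g' f' X
            \<cdot>\<^bsub>PCat P C\<^esub> PNat P B C b (FOb (PFun P A B f') X)
            \<cdot>\<^bsub>PCat P C\<^esub> FArr (PFun P B C g) (PNat P A B a X)"
    and p_assoc:
      "\<lbrakk>A \<in> Ob0 \<K>; B \<in> Ob0 \<K>; C \<in> Ob0 \<K>; D \<in> Ob0 \<K>;
        f \<in> Ob (HC \<K> A B); g \<in> Ob (HC \<K> B C); h \<in> Ob (HC \<K> C D); X \<in> Ob (PCat P A)\<rbrakk>
       \<Longrightarrow> PNat P A D (Assoc \<K> A B C D h g f) X
            \<cdot>\<^bsub>PCat P D\<^esub> PComp P A B D (cmp1 \<K> B C D h g) f X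
            \<cdot>\<^bsub>PCat P D\<^esub> PComp P B C D h g (FOb (PFun P A B f) X)
          = PComp P A C D h (cmp1 \<K> A B C g f) X
            \<cdot>\<^bsub>PCat P D\<^esub> FArr (PFun P C D h) (PComp P A B C g f X)"
    and p_lunit:
      "\<lbrakk>A \<in> Ob0 \<K>; B \<in> Ob0 \<K>; f \<in> Ob (HC \<K> A B); X \<in> Ob (PCat P A)\<rbrakk>
       \<Longrightarrow> PNat P A B (LUnit \<K> A B f) X
            \<cdot>\<^bsub>PCat P B\<^esub> PComp P A B B (Id1 \<K> B) f X
            \<cdot>\<^bsub>PCat P B\<^esub> PUnit P B (FOb (PFun P A B f) X)
          = Idn (PCat P B) (FOb (PFun P A B f) X)"
    and p_runit:
      "\<lbrakk>A \<in> Ob0 \<K>; B \<in> Ob0 \<K>; f \<in> Ob (HC \<K> A B); X \<in> Ob (PCat P A)\<rbrakk>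
       \<Longrightarrow> PNat P A B (RUnit \<K> A B f) X
            \<cdot>\<^bsub>PCat P B\<^esub> PComp P A A B f (Id1 \<K> A) X
            \<cdot>\<^bsub>PCat P B\<^esub> FArr (PFun P A B f) (PUnit P A X)
          = Idn (PCat P B) (FOb (PFun P A B f) X)"

definition indexed_category ::
  "('o, 'm, 'c) bicat \<Rightarrow> ('o, 'm, 'c, 'x, 'a) psfun \<Rightarrow> bool" where
  "indexed_category \<B> P \<longleftrightarrow> pseudofunctor_Cat (op_bicat \<B>) P"

text \<open>
  Notation for a \<open>\<B>\<close>-indexed category in terms of the 1-cells \<open>f : A \<rightarrow> B\<close>, \<open>g : B \<rightarrow> C\<close>
  and 2-cells \<open>m : f \<Rightarrow> f'\<close> of \<open>\<B>\<close> itself, which are 1-cells \<open>B \<rightarrow> A\<close>, \<open>C \<rightarrow> B\<close> and a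
  2-cell of the dual: \<open>reidx P A B f\<close> is the functor \<open>f\<^sup>* : P B \<rightarrow> P A\<close>,
  \<open>reidx2 P A B m\<close> the transformation \<open>f\<^sup>* \<Rightarrow> f'\<^sup>*\<close>, and \<open>theta P A B C f g\<close> the
  coherence isomorphism \<open>f\<^sup>* \<circ> g\<^sup>* \<Rightarrow> (g \<circ> f)\<^sup>*\<close>.
\<close>

abbreviation reidx ::
  "('o, 'm, 'c, 'x, 'a) psfun \<Rightarrow> 'o \<Rightarrow> 'o \<Rightarrow> 'm \<Rightarrow> ('x, 'a, 'x, 'a) func" where
  "reidx P A B f \<equiv> PFun P B A f"

abbreviation reidx2 ::
  "('o, 'm, 'c, 'x, 'a) psfun \<Rightarrow> 'o \<Rightarrow> 'o \<Rightarrow> 'c \<Rightarrow> 'x \<Rightarrow> 'a" where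
  "reidx2 P A B m \<equiv> PNat P B A m"

abbreviation theta ::
  "('o, 'm, 'c, 'x, 'a) psfun \<Rightarrow> 'o \<Rightarrow> 'o \<Rightarrow> 'o \<Rightarrow> 'm \<Rightarrow> 'm \<Rightarrow> 'x \<Rightarrow> 'a" where
  "theta P A B C f g \<equiv> PComp P C B A f g"


section \<open>Dependent optics\<close>

text \<open>The object \<open>(X, X')\<^sup>A\<close> is encoded as \<open>(A, X, X')\<close>.\<close>

type_synonym ('o, 'x, 'y) optic_ob = "'o \<times> 'x \<times> 'y"

text \<open>A pair \<open>(l, r)\<close> together with its representative \<open>f\<close> is encoded as \<open>(f, l, r)\<close>.\<close>

type_synonym ('m, 'a, 'b) optic_rep = "'m \<times> 'a \<times> 'b"

text \<open>A morphism is an equivalence class tagged with its domain and codomain, which the class alone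
  need not determine (\<open>f\<^sup>*\<close> need not be injective on objects).\<close>

type_synonym ('o, 'm, 'x, 'a, 'y, 'b) optic_arr =
  "('o, 'x, 'y) optic_ob \<times> ('o, 'x, 'y) optic_ob \<times> ('m, 'a, 'b) optic_rep set"

context
  fixes \<B> :: "('o, 'm, 'c) bicat"
    and \<L> :: "('o, 'm, 'c, 'x, 'a) psfun"
    and \<R> :: "('o, 'm, 'c, 'y, 'b) psfun"
begin

definition optic_obs :: "('o, 'x, 'y) optic_ob set" where
  "optic_obs = {(A, X, X'). A \<in> Ob0 \<B> \<and> X \<in> Ob (PCat \<L> A) \<and> X' \<in> Ob (PCat \<R> A)}"

fun optic_reps ::
  "('o, 'x, 'y) optic_ob \<Rightarrow> ('o, 'x, 'y) optic_ob \<Rightarrow> ('m, 'a, 'b) optic_rep set" where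
  "optic_reps (A, X, X') (B, Y, Y') =
    {(f, l, r). f \<in> Ob (HC \<B> A B) \<and>
                l \<in> Hom (PCat \<L> A) X (FOb (reidx \<L> A B f) Y) \<and>
                r \<in> Hom (PCat \<R> A) (FOb (reidx \<R> A B f) Y') X'}"

inductive optic_step ::
  "('o, 'x, 'y) optic_ob \<Rightarrow> ('o, 'x, 'y) optic_ob
   \<Rightarrow> ('m, 'a, 'b) optic_rep \<Rightarrow> ('m, 'a, 'b) optic_rep \<Rightarrow> bool" where
  "\<lbrakk>m \<in> Hom (HC \<B> A B) f g;
    l \<in> Hom (PCat \<L> A) X (FOb (reidx \<L> A B f) Y);
    r \<in> Hom (PCat \<R> A) (FOb (reidx \<R> A B g) Y') X'\<rbrakk>
   \<Longrightarrow> optic_step (A, X, X') (B, Y, Y')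
         (g, reidx2 \<L> A B m Y \<cdot>\<^bsub>PCat \<L> A\<^esub> l, r)
         (f, l, r \<cdot>\<^bsub>PCat \<R> A\<^esub> reidx2 \<R> A B m Y')"

definition optic_rel ::
  "('o, 'x, 'y) optic_ob \<Rightarrow> ('o, 'x, 'y) optic_ob \<Rightarrow> ('m, 'a, 'b) optic_rep rel" where
  "optic_rel S T =
    {(p, q). p \<in> optic_reps S T \<and> q \<in> optic_reps S T \<and> equivclp (optic_step S T) p q}"

definition optic_class ::
  "('o, 'x, 'y) optic_ob \<Rightarrow> ('o, 'x, 'y) optic_ob \<Rightarrow> ('m, 'a, 'b) optic_rep
   \<Rightarrow> ('o, 'm, 'x, 'a, 'y, 'b) optic_arr" where
  "optic_class S T p = (S, T, optic_rel S T `` {p})"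

fun id_rep :: "('o, 'x, 'y) optic_ob \<Rightarrow> ('m, 'a, 'b) optic_rep" where
  "id_rep (A, X, X') = (Id1 \<B> A, PUnit \<L> A X, inv_arr (PCat \<R> A) (PUnit \<R> A X'))"

fun cmp_rep ::
  "('o, 'x, 'y) optic_ob \<Rightarrow> ('o, 'x, 'y) optic_ob \<Rightarrow> ('o, 'x, 'y) optic_ob
   \<Rightarrow> ('m, 'a, 'b) optic_rep \<Rightarrow> ('m, 'a, 'b) optic_rep \<Rightarrow> ('m, 'a, 'b) optic_rep" where
  "cmp_rep (A, X, X') (B, Y, Y') (C, Z, Z') (g, l2, r2) (f, l1, r1) =
    (cmp1 \<B> A B C g f,
     theta \<L> A B C f g Z \<cdot>\<^bsub>PCat \<L> A\<^esub> FArr (reidx \<L> A B f) l2 \<cdot>\<^bsub>PCat \<L> A\<^esub> l1,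
     r1 \<cdot>\<^bsub>PCat \<R> A\<^esub> FArr (reidx \<R> A B f) r2
        \<cdot>\<^bsub>PCat \<R> A\<^esub> inv_arr (PCat \<R> A) (theta \<R> A B C f g Z'))"

text \<open>
  The union in the composite is over all choices of representatives of the two classes; it is
  a single equivalence class exactly because composition is well defined.
\<close>

fun optic_cmp ::
  "('o, 'm, 'x, 'a, 'y, 'b) optic_arr \<Rightarrow> ('o, 'm, 'x, 'a, 'y, 'b) optic_arr
   \<Rightarrow> ('o, 'm, 'x, 'a, 'y, 'b) optic_arr" where
  "optic_cmp (T', U, Q) (S, T, P) =
    (S, U, \<Union>q\<in>Q. \<Union>p\<in>P. optic_rel S U `` {cmp_rep S T U q p})"

definition Optic ::
  "(('o, 'x, 'y) optic_ob, ('o, 'm, 'x, 'a, 'y, 'b) optic_arr) cat" where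
  "Optic =
    \<lparr>Ob = optic_obs,
     Arr = {(S, T, E). S \<in> optic_obs \<and> T \<in> optic_obs \<and> E \<in> optic_reps S T // optic_rel S T},
     Dom = (\<lambda>(S, T, E). S),
     Cod = (\<lambda>(S, T, E). T),
     Idn = (\<lambda>S. optic_class S S (id_rep S)),
     Cmp = optic_cmp\<rparr>"

end

end

theory Submission
  imports Defs
begin

text \<open>
  Each law holds already at the level of representatives, up to one generating step of the
  equivalence relation: the step is taken along a whiskered 2-cell for well-definedness of the
  composition, along the associator for associativity, and along the unitors for the unit laws.
  On the \<open>\<L>\<close>-side this is the coherence of the pseudofunctor, on the \<open>\<R>\<close>-side
  the same coherence for the inverses of \<open>\<theta>'\<close>.
\<close>

section \<open>Isomorphisms in a category\<close>

text \<open>A step along a 2-cell \<open>m\<close> uses \<open>\<L>(m)\<close> and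
  \<open>\<R>(m)\<close> themselves, never inverses, whereas right components are composed with the
  inverses of \<theta>', although the axioms speak of \<theta>'. Each coherence law is therefore
  read as a commuting square with (composites of) \<theta>' on two opposite sides, and only these
  two sides are inverted: \<open>\<R>(m)\<close> must survive as it is, since a whiskered
  \<open>m\<close> need not be invertible. The unit laws are the degenerate case, where
  \<open>\<R>\<close> of the unitor turns out to be the inverse of such a composite. One and the
  same 2-cell has to serve both components, so each law splits into an equation in a fibre of
  \<open>\<L>\<close> and one in a fibre of \<open>\<R>\<close>. A second obstacle is that an
  indexed category lives on the dual bicategory, whose associator is inverted and whose unitors are
  exchanged; its laws have to be brought back to the 2-cells of \<open>\<B>\<close>. Finally,
  related pairs are joined by chains of steps in either direction. No normal form is needed, because
  an operation that preserves single steps preserves the generated equivalence.\<close>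

context category
begin

text \<open>The axioms of \<open>category\<close> have premises with objects that are absent from
  the conclusion, which makes them poor rewrite rules. In terms of \<open>Dom\<close> and
  \<open>Cod\<close> the side conditions become equations, and after unfolding
  \<open>Hom_def\<close> the simplifier can nest typed composites to the right.\<close>

lemma arr_cmp:
  assumes "f \<in> Arr C" "g \<in> Arr C" "Cod C f = Dom C g"
  shows "g \<cdot> f \<in> Arr C" "Dom C (g \<cdot> f) = Dom C f" "Cod C (g \<cdot> f) = Cod C g"
  using cmp_hom[of f "Dom C f" "Cod C f" g "Cod C g"] assms by (auto simp: Hom_def)

lemma arr_assoc:
  assumes "f \<in> Arr C" "g \<in> Arr C" "h \<in> Arr C" "Cod C f = Dom C g" "Cod C g = Dom C h"
  shows "(h \<cdot> g) \<cdot> f = h \<cdot> (g \<cdot> f)"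
  using cmp_assoc[of f "Dom C f" "Cod C f" g "Cod C g" h "Cod C h"] assms
  by (auto simp: Hom_def)

lemma arr_id:
  assumes "f \<in> Arr C"
  shows "Cod C f = y \<Longrightarrow> Idn C y \<cdot> f = f" "Dom C f = x \<Longrightarrow> f \<cdot> Idn C x = f"
  using id_left[of f "Dom C f" y] id_right[of f x "Cod C f"] assms by (auto simp: Hom_def)

lemmas arr_simps = arr_cmp arr_assoc arr_id

lemma hom_ob: "f \<in> Hom C x y \<Longrightarrow> x \<in> Ob C \<and> y \<in> Ob C"
  using dom_ob cod_ob by (auto simp: Hom_def)

text \<open>Composites nest to the right, so one side of a square
  \<open>b \<cdot> a = d \<cdot> c\<close> is no subterm once an arrow \<open>k\<close> comes before
  it. This is the form in which coherence and naturality squares serve for rewriting.\<close>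

lemma cmp_eq_right:
  assumes "b \<cdot> a = d \<cdot> c" "k \<in> Hom C w x"
    "a \<in> Hom C x y" "b \<in> Hom C y z" "c \<in> Hom C x v" "d \<in> Hom C v z"
  shows "b \<cdot> (a \<cdot> k) = d \<cdot> (c \<cdot> k)"
  using cmp_assoc[OF assms(2,3,4)] cmp_assoc[OF assms(2,5,6)] assms(1) by simp

lemma inverse_arrows_unique:
  assumes "inverse_arrows C f g" "inverse_arrows C f h"
  shows "g = h"
proof -
  have f: "f \<in> Hom C (Dom C f) (Cod C f)"
    and g: "g \<in> Hom C (Cod C f) (Dom C f)" "g \<cdot> f = Idn C (Dom C f)"
    and h: "h \<in> Hom C (Cod C f) (Dom C f)" "f \<cdot> h = Idn C (Cod C f)"
    using assms by (simp_all add: inverse_arrows_def)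
  have "g = g \<cdot> (f \<cdot> h)"
    using id_right[OF g(1)] h(2) by simp
  also have "\<dots> = h"
    using cmp_assoc[OF h(1) f g(1)] id_left[OF h(1)] g(2) by simp
  finally show ?thesis .
qed

text \<open>\<open>inv_arr\<close> is a definite description, so uniqueness of inverses is what
  gives it its meaning.\<close>

lemma inverse_arrows_inv_arr:
  assumes "is_iso C f"
  shows "inverse_arrows C f (inv_arr C f)"
proof -
  obtain g where g: "inverse_arrows C f g"
    using assms by (auto simp: is_iso_def)
  show ?thesis
    unfolding inv_arr_def
    by (rule theI[of "inverse_arrows C f", OF g]) (rule inverse_arrows_unique[OF _ g])
qed

lemma inverse_arrowsD:
  assumes "inverse_arrows C f g" "f \<in> Hom C x y"
  shows "g \<in> Hom C y x" "g \<cdot> f = Idn C x" "f \<cdot> g = Idn C y"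
  using assms by (auto simp: inverse_arrows_def Hom_def)

lemma inverse_arrowsI:
  assumes "f \<in> Hom C x y" "g \<in> Hom C y x" "g \<cdot> f = Idn C x" "f \<cdot> g = Idn C y"
  shows "inverse_arrows C f g"
  using assms by (auto simp: inverse_arrows_def Hom_def)

lemma inverse_arrows_cmp:
  assumes "inverse_arrows C f f'" "f \<in> Hom C x y" "inverse_arrows C g g'" "g \<in> Hom C y z"
  shows "inverse_arrows C (g \<cdot> f) (f' \<cdot> g')"
proof (rule inverse_arrowsI)
  note f = inverse_arrowsD[OF assms(1,2)] and g = inverse_arrowsD[OF assms(3,4)]
  show "g \<cdot> f \<in> Hom C x z" "f' \<cdot> g' \<in> Hom C z x"
    using f g assms cmp_hom by blast+
  have "(f' \<cdot> g') \<cdot> (g \<cdot> f) = f' \<cdot> ((g' \<cdot> g) \<cdot> f)"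
    using f(1) g(1) assms(2,4) by (simp add: Hom_def arr_simps)
  then show "(f' \<cdot> g') \<cdot> (g \<cdot> f) = Idn C x"
    using f g assms(2) id_left by simp
  have "(g \<cdot> f) \<cdot> (f' \<cdot> g') = g \<cdot> ((f \<cdot> f') \<cdot> g')"
    using f(1) g(1) assms(2,4) by (simp add: Hom_def arr_simps)
  then show "(g \<cdot> f) \<cdot> (f' \<cdot> g') = Idn C z"
    using f g id_left by simp
qed

text \<open>Meant for the unit laws, which say that the image of a unitor composed with an
  invertible composite is an identity.\<close>

lemma left_inverse_unique:
  assumes "a \<cdot> u = Idn C x" "u \<in> Hom C x y" "a \<in> Hom C y x" "inverse_arrows C u u'"
  shows "a = u'"
proof -
  note u = inverse_arrowsD[OF assms(4,2)]
  have "a = (a \<cdot> u) \<cdot> u'"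
    using cmp_assoc[OF u(1) assms(2,3)] id_right[OF assms(3)] u(3) by simp
  also have "\<dots> = u'"
    unfolding assms(1) by (rule id_left[OF u(1)])
  finally show ?thesis .
qed

text \<open>Inverting the two parallel sides \<open>u\<close> and \<open>v\<close> leaves
  \<open>a\<close> and \<open>b\<close> in their original direction. This is the passage from a law
  for \<theta> to the law for its inverse.\<close>

lemma inverse_square:
  assumes "a \<cdot> u = v \<cdot> b"
    "a \<in> Hom C y y'" "u \<in> Hom C x y" "v \<in> Hom C x' y'" "b \<in> Hom C x x'"
    "inverse_arrows C u u'" "inverse_arrows C v v'"
  shows "v' \<cdot> a = b \<cdot> u'"
proof -
  note u = inverse_arrowsD[OF assms(6,3)] and v = inverse_arrowsD[OF assms(7,4)]
  \<comment> \<open>Padding \<open>a\<close> with the identity \<open>u \<cdot> u'\<close> creates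
    one side of the given square.\<close>
  have "v' \<cdot> a = v' \<cdot> ((a \<cdot> u) \<cdot> u')"
    using u assms(2-5) cmp_assoc id_right by metis
  also have "\<dots> = (v' \<cdot> v) \<cdot> (b \<cdot> u')"
    unfolding assms(1) using u(1) v(1) assms(2-5) by (simp add: Hom_def arr_simps)
  also have "\<dots> = b \<cdot> u'"
    using u(1) v assms(5) cmp_hom id_left by metis
  finally show ?thesis .
qed

end


section \<open>Indexed categories\<close>

lemma op_bicat_simps:
  "Ob0 (op_bicat \<B>) = Ob0 \<B>" "HC (op_bicat \<B>) A B = HC \<B> B A" "Id1 (op_bicat \<B>) = Id1 \<B>"
  "cmp1 (op_bicat \<B>) A B C g f = cmp1 \<B> C B A f g"
  "cmp2 (op_bicat \<B>) A B C b a = cmp2 \<B> C B A a b"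
  "Assoc (op_bicat \<B>) A B C D h g f = inv_arr (HC \<B> D A) (Assoc \<B> D C B A f g h)"
  "LUnit (op_bicat \<B>) A B f = RUnit \<B> B A f"
  "RUnit (op_bicat \<B>) A B f = LUnit \<B> B A f"
  by (simp_all add: op_bicat_def)

lemma func_simps:
  "FOb id_func x = x" "FArr id_func a = a"
  "FOb (cmp_func G F) x = FOb G (FOb F x)" "FArr (cmp_func G F) a = FArr G (FArr F a)"
  by (simp_all add: id_func_def cmp_func_def)

context bicategory
begin

lemma hom1:
  assumes "A \<in> Ob0 \<B>" "B \<in> Ob0 \<B>" "m \<in> Hom (HC \<B> A B) f f'"
  shows "f \<in> Ob (HC \<B> A B)" "f' \<in> Ob (HC \<B> A B)"
  using category.hom_ob[OF hom_category] assms by blast+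

lemma id2_hom:
  assumes "A \<in> Ob0 \<B>" "B \<in> Ob0 \<B>" "f \<in> Ob (HC \<B> A B)"
  shows "Idn (HC \<B> A B) f \<in> Hom (HC \<B> A B) f f"
  using category.id_hom[OF hom_category] assms by blast

lemma cmp1_ob:
  assumes "A \<in> Ob0 \<B>" "B \<in> Ob0 \<B>" "C \<in> Ob0 \<B>" "f \<in> Ob (HC \<B> A B)" "g \<in> Ob (HC \<B> B C)"
  shows "cmp1 \<B> A B C g f \<in> Ob (HC \<B> A C)"
  using is_functor.fun_ob[OF hcmp_functor[OF assms(1-3)], of "(g, f)"] assms
  by (simp add: prod_cat_def)

lemma cmp2_hom:
  assumes "A \<in> Ob0 \<B>" "B \<in> Ob0 \<B>" "C \<in> Ob0 \<B>"
    "a \<in> Hom (HC \<B> A B) f f'" "b \<in> Hom (HC \<B> B C) g g'"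
  shows "cmp2 \<B> A B C b a \<in> Hom (HC \<B> A C) (cmp1 \<B> A B C g f) (cmp1 \<B> A B C g' f')"
  using is_functor.fun_hom[OF hcmp_functor[OF assms(1-3)], of "(b, a)" "(g, f)" "(g', f')"] assms
  by (simp add: prod_cat_def Hom_def)

end

locale indexed = bicategory \<B> for \<B> :: "('o, 'm, 'c) bicat" +
  fixes P :: "('o, 'm, 'c, 'x, 'a) psfun"
  assumes indexed: "indexed_category \<B> P"
begin

lemma pseudofunctor: "pseudofunctor_Cat (op_bicat \<B>) P"
  using indexed by (simp add: indexed_category_def)

lemma fib_category: "A \<in> Ob0 \<B> \<Longrightarrow> category (PCat P A)"
  using pseudofunctor_Cat.p_category[OF pseudofunctor] by (simp add: op_bicat_simps)

context
  fixes A B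
  assumes AB: "A \<in> Ob0 \<B>" "B \<in> Ob0 \<B>"
begin

text \<open>A 1-cell \<open>A \<rightarrow> B\<close> of \<open>\<B>\<close> is a 1-cell
  \<open>B \<rightarrow> A\<close> of the dual, hence the reversed order of objects in this and all
  later instantiations of the pseudofunctor axioms.\<close>

lemma reidx_functor:
  "f \<in> Ob (HC \<B> A B) \<Longrightarrow> is_functor (PCat P B) (PCat P A) (reidx P A B f)"
  by (rule pseudofunctor_Cat.p_functor[OF pseudofunctor, unfolded op_bicat_simps, OF AB(2,1)])

lemma reidx2_nat_trans:
  "m \<in> Hom (HC \<B> A B) f f' \<Longrightarrow>
    nat_trans (PCat P B) (PCat P A) (reidx P A B f) (reidx P A B f') (reidx2 P A B m)"
  by (rule pseudofunctor_Cat.p_nat_trans[OF pseudofunctor, unfolded op_bicat_simps, OF AB(2,1)])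

lemma reidx_ob:
  "\<lbrakk>f \<in> Ob (HC \<B> A B); X \<in> Ob (PCat P B)\<rbrakk> \<Longrightarrow> FOb (reidx P A B f) X \<in> Ob (PCat P A)"
  using is_functor.fun_ob[OF reidx_functor] by blast

lemma reidx_hom:
  "\<lbrakk>f \<in> Ob (HC \<B> A B); a \<in> Hom (PCat P B) X Y\<rbrakk>
   \<Longrightarrow> FArr (reidx P A B f) a \<in> Hom (PCat P A) (FOb (reidx P A B f) X) (FOb (reidx P A B f) Y)"
  using is_functor.fun_hom[OF reidx_functor] by blast

lemma reidx_id:
  "\<lbrakk>f \<in> Ob (HC \<B> A B); X \<in> Ob (PCat P B)\<rbrakk>
   \<Longrightarrow> FArr (reidx P A B f) (Idn (PCat P B) X) = Idn (PCat P A) (FOb (reidx P A B f) X)"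
  using is_functor.fun_id[OF reidx_functor] by blast

lemma reidx_cmp:
  "\<lbrakk>f \<in> Ob (HC \<B> A B); a \<in> Hom (PCat P B) X Y; b \<in> Hom (PCat P B) Y Z\<rbrakk>
   \<Longrightarrow> FArr (reidx P A B f) (b \<cdot>\<^bsub>PCat P B\<^esub> a)
      = FArr (reidx P A B f) b \<cdot>\<^bsub>PCat P A\<^esub> FArr (reidx P A B f) a"
  using is_functor.fun_cmp[OF reidx_functor] by blast

text \<open>Functors preserve inverses. This is needed where a coherence law contains
  \<open>f\<^sup>*\<close> of a component of \<theta>, as the associativity law and one of the unit
  laws do.\<close>

lemma reidx_inverse_arrows:
  assumes "f \<in> Ob (HC \<B> A B)" "inverse_arrows (PCat P B) a b" "a \<in> Hom (PCat P B) X Y"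
  shows "inverse_arrows (PCat P A) (FArr (reidx P A B f) a) (FArr (reidx P A B f) b)"
proof (rule category.inverse_arrowsI)
  interpret B: category "PCat P B" by (rule fib_category[OF AB(2)])
  note b = B.inverse_arrowsD[OF assms(2,3)] and XY = B.hom_ob[OF assms(3)]
  show "category (PCat P A)" by (rule fib_category[OF AB(1)])
  show "FArr (reidx P A B f) a \<in> Hom (PCat P A) (FOb (reidx P A B f) X) (FOb (reidx P A B f) Y)"
    "FArr (reidx P A B f) b \<in> Hom (PCat P A) (FOb (reidx P A B f) Y) (FOb (reidx P A B f) X)"
    using assms b reidx_hom by blast+
  show "FArr (reidx P A B f) b \<cdot>\<^bsub>PCat P A\<^esub> FArr (reidx P A B f) a
      = Idn (PCat P A) (FOb (reidx P A B f) X)"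
    using assms b XY reidx_cmp reidx_id by metis
  show "FArr (reidx P A B f) a \<cdot>\<^bsub>PCat P A\<^esub> FArr (reidx P A B f) b
      = Idn (PCat P A) (FOb (reidx P A B f) Y)"
    using assms b XY reidx_cmp reidx_id by metis
qed

lemma reidx2_hom:
  assumes "m \<in> Hom (HC \<B> A B) f f'" "X \<in> Ob (PCat P B)"
  shows "reidx2 P A B m X \<in> Hom (PCat P A) (FOb (reidx P A B f) X) (FOb (reidx P A B f') X)"
  using nat_trans.component[OF reidx2_nat_trans] assms by blast

lemma reidx2_natural:
  assumes "m \<in> Hom (HC \<B> A B) f f'" "a \<in> Hom (PCat P B) X Y"
  shows "reidx2 P A B m Y \<cdot>\<^bsub>PCat P A\<^esub> FArr (reidx P A B f) a
    = FArr (reidx P A B f') a \<cdot>\<^bsub>PCat P A\<^esub> reidx2 P A B m X"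
  using nat_trans.naturality[OF reidx2_nat_trans] assms by blast

lemma reidx2_id:
  assumes "f \<in> Ob (HC \<B> A B)" "X \<in> Ob (PCat P B)"
  shows "reidx2 P A B (Idn (HC \<B> A B) f) X = Idn (PCat P A) (FOb (reidx P A B f) X)"
  using pseudofunctor_Cat.p_id2[OF pseudofunctor, unfolded op_bicat_simps] AB assms by blast

lemma reidx2_cmp:
  assumes "m \<in> Hom (HC \<B> A B) f f'" "m' \<in> Hom (HC \<B> A B) f' f''" "X \<in> Ob (PCat P B)"
  shows "reidx2 P A B (m' \<cdot>\<^bsub>HC \<B> A B\<^esub> m) X = reidx2 P A B m' X \<cdot>\<^bsub>PCat P A\<^esub> reidx2 P A B m X"
  using pseudofunctor_Cat.p_vcmp[OF pseudofunctor, unfolded op_bicat_simps] AB assms by blast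

end

context
  fixes A
  assumes A: "A \<in> Ob0 \<B>"
begin

lemmas unit_iso = pseudofunctor_Cat.p_unit_iso[OF pseudofunctor, unfolded op_bicat_simps, OF A]

lemma unit_hom:
  assumes "X \<in> Ob (PCat P A)"
  shows "PUnit P A X \<in> Hom (PCat P A) X (FOb (reidx P A A (Id1 \<B> A)) X)"
  using nat_trans.component[OF nat_iso.axioms(1)[OF unit_iso]] assms by (simp add: func_simps)

lemma unit_natural:
  assumes "a \<in> Hom (PCat P A) X Y"
  shows "PUnit P A Y \<cdot>\<^bsub>PCat P A\<^esub> a = FArr (reidx P A A (Id1 \<B> A)) a \<cdot>\<^bsub>PCat P A\<^esub> PUnit P A X"
  using nat_trans.naturality[OF nat_iso.axioms(1)[OF unit_iso]] assms by (simp add: func_simps)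

lemma unit_inverse:
  assumes "X \<in> Ob (PCat P A)"
  shows "inverse_arrows (PCat P A) (PUnit P A X) (inv_arr (PCat P A) (PUnit P A X))"
  by (rule category.inverse_arrows_inv_arr[OF fib_category[OF A]
        nat_iso.component_iso[OF unit_iso assms]])

lemma unit_inv_hom:
  assumes "X \<in> Ob (PCat P A)"
  shows "inv_arr (PCat P A) (PUnit P A X) \<in> Hom (PCat P A) (FOb (reidx P A A (Id1 \<B> A)) X) X"
  by (rule category.inverse_arrowsD(1)[OF fib_category[OF A]
        unit_inverse[OF assms] unit_hom[OF assms]])

lemma unit_inv_natural:
  assumes "a \<in> Hom (PCat P A) X Y"
  shows "inv_arr (PCat P A) (PUnit P A Y) \<cdot>\<^bsub>PCat P A\<^esub> FArr (reidx P A A (Id1 \<B> A)) a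
    = a \<cdot>\<^bsub>PCat P A\<^esub> inv_arr (PCat P A) (PUnit P A X)"
proof -
  interpret category "PCat P A" by (rule fib_category[OF A])
  have X: "X \<in> Ob (PCat P A)" and Y: "Y \<in> Ob (PCat P A)"
    using hom_ob[OF assms] by auto
  show ?thesis
    by (rule inverse_square[OF unit_natural[OF assms, symmetric]
          reidx_hom[OF A A id1_ob[OF A] assms] unit_hom[OF X] unit_hom[OF Y] assms
          unit_inverse[OF X] unit_inverse[OF Y]])
qed

end

section \<open>Coherence of \<theta> and of its inverse\<close>

context
  fixes A B C
  assumes ABC: "A \<in> Ob0 \<B>" "B \<in> Ob0 \<B>" "C \<in> Ob0 \<B>"
begin

lemmas theta_iso =
  pseudofunctor_Cat.p_comp_iso[OF pseudofunctor, unfolded op_bicat_simps, OF ABC(3,2,1)]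

lemma theta_hom:
  assumes "f \<in> Ob (HC \<B> A B)" "g \<in> Ob (HC \<B> B C)" "X \<in> Ob (PCat P C)"
  shows "theta P A B C f g X \<in> Hom (PCat P A)
    (FOb (reidx P A B f) (FOb (reidx P B C g) X)) (FOb (reidx P A C (cmp1 \<B> A B C g f)) X)"
  using nat_trans.component[OF nat_iso.axioms(1)[OF theta_iso[OF assms(2,1)]] assms(3)]
  by (simp add: func_simps)

lemma theta_natural:
  assumes "f \<in> Ob (HC \<B> A B)" "g \<in> Ob (HC \<B> B C)" "a \<in> Hom (PCat P C) X Y"
  shows "theta P A B C f g Y \<cdot>\<^bsub>PCat P A\<^esub> FArr (reidx P A B f) (FArr (reidx P B C g) a)
    = FArr (reidx P A C (cmp1 \<B> A B C g f)) a \<cdot>\<^bsub>PCat P A\<^esub> theta P A B C f g X"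
  using nat_trans.naturality[OF nat_iso.axioms(1)[OF theta_iso[OF assms(2,1)]] assms(3)]
  by (simp add: func_simps)

lemma theta_inverse:
  assumes "f \<in> Ob (HC \<B> A B)" "g \<in> Ob (HC \<B> B C)" "X \<in> Ob (PCat P C)"
  shows "inverse_arrows (PCat P A) (theta P A B C f g X)
    (inv_arr (PCat P A) (theta P A B C f g X))"
  by (rule category.inverse_arrows_inv_arr[OF fib_category[OF ABC(1)]
        nat_iso.component_iso[OF theta_iso[OF assms(2,1)] assms(3)]])

lemma theta_inv_hom:
  assumes "f \<in> Ob (HC \<B> A B)" "g \<in> Ob (HC \<B> B C)" "X \<in> Ob (PCat P C)"
  shows "inv_arr (PCat P A) (theta P A B C f g X) \<in> Hom (PCat P A)
    (FOb (reidx P A C (cmp1 \<B> A B C g f)) X) (FOb (reidx P A B f) (FOb (reidx P B C g) X))"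
  by (rule category.inverse_arrowsD(1)[OF fib_category[OF ABC(1)]
        theta_inverse[OF assms] theta_hom[OF assms]])

lemma theta_inv_natural:
  assumes "f \<in> Ob (HC \<B> A B)" "g \<in> Ob (HC \<B> B C)" "a \<in> Hom (PCat P C) X Y"
  shows "inv_arr (PCat P A) (theta P A B C f g Y)
      \<cdot>\<^bsub>PCat P A\<^esub> FArr (reidx P A C (cmp1 \<B> A B C g f)) a
    = FArr (reidx P A B f) (FArr (reidx P B C g) a)
      \<cdot>\<^bsub>PCat P A\<^esub> inv_arr (PCat P A) (theta P A B C f g X)"
proof -
  interpret category "PCat P A" by (rule fib_category[OF ABC(1)])
  have X: "X \<in> Ob (PCat P C)" and Y: "Y \<in> Ob (PCat P C)"
    using category.hom_ob[OF fib_category[OF ABC(3)] assms(3)] by auto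
  show ?thesis
    by (rule inverse_square[OF theta_natural[OF assms, symmetric]
          reidx_hom[OF ABC(1,3) cmp1_ob[OF ABC assms(1,2)] assms(3)]
          theta_hom[OF assms(1,2) X] theta_hom[OF assms(1,2) Y]
          reidx_hom[OF ABC(1,2) assms(1) reidx_hom[OF ABC(2,3) assms(2,3)]]
          theta_inverse[OF assms(1,2) X] theta_inverse[OF assms(1,2) Y]])
qed

lemma theta_natural2:
  assumes "m \<in> Hom (HC \<B> A B) f f'" "n \<in> Hom (HC \<B> B C) g g'" "X \<in> Ob (PCat P C)"
  shows "reidx2 P A C (cmp2 \<B> A B C n m) X \<cdot>\<^bsub>PCat P A\<^esub> theta P A B C f g X
    = theta P A B C f' g' X \<cdot>\<^bsub>PCat P A\<^esub> reidx2 P A B m (FOb (reidx P B C g') X)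
      \<cdot>\<^bsub>PCat P A\<^esub> FArr (reidx P A B f) (reidx2 P B C n X)"
  by (rule pseudofunctor_Cat.p_comp_natural[OF pseudofunctor, unfolded op_bicat_simps,
        OF ABC(3,2,1) assms(2,1,3)])

text \<open>The 2-cell on \<open>g\<close> is an identity, so the last factor in
  \<open>theta_natural2\<close> is the reindexing of an identity and drops out. Whiskerings suffice
  later because the two arguments of a composite are varied one at a time.\<close>

lemma theta_whisker_right:
  assumes m: "m \<in> Hom (HC \<B> A B) f f'" and g: "g \<in> Ob (HC \<B> B C)" and X: "X \<in> Ob (PCat P C)"
  shows "reidx2 P A C (cmp2 \<B> A B C (Idn (HC \<B> B C) g) m) X \<cdot>\<^bsub>PCat P A\<^esub> theta P A B C f g X
    = theta P A B C f' g X \<cdot>\<^bsub>PCat P A\<^esub> reidx2 P A B m (FOb (reidx P B C g) X)"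
proof -
  interpret category "PCat P A" by (rule fib_category[OF ABC(1)])
  note gX = reidx_ob[OF ABC(2,3) g X]
  show ?thesis
    unfolding theta_natural2[OF m id2_hom[OF ABC(2,3) g] X] reidx2_id[OF ABC(2,3) g X]
      reidx_id[OF ABC(1,2) hom1(1)[OF ABC(1,2) m] gX]
      id_right[OF reidx2_hom[OF ABC(1,2) m gX]] ..
qed

lemma theta_whisker_left:
  assumes f: "f \<in> Ob (HC \<B> A B)" and n: "n \<in> Hom (HC \<B> B C) g g'" and X: "X \<in> Ob (PCat P C)"
  shows "reidx2 P A C (cmp2 \<B> A B C n (Idn (HC \<B> A B) f)) X \<cdot>\<^bsub>PCat P A\<^esub> theta P A B C f g X
    = theta P A B C f g' X \<cdot>\<^bsub>PCat P A\<^esub> FArr (reidx P A B f) (reidx2 P B C n X)"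
proof -
  interpret category "PCat P A" by (rule fib_category[OF ABC(1)])
  note gX = reidx_ob[OF ABC(2,3) hom1(2)[OF ABC(2,3) n] X]
  show ?thesis
    unfolding theta_natural2[OF id2_hom[OF ABC(1,2) f] n X] reidx2_id[OF ABC(1,2) f gX]
      id_left[OF reidx_hom[OF ABC(1,2) f reidx2_hom[OF ABC(2,3) n X]]] ..
qed

text \<open>In \<open>theta_whisker_right\<close> the two components of \<theta> are opposite sides
  of a square; they are inverted while both images of 2-cells keep their direction.\<close>

lemma theta_inv_whisker_right:
  assumes m: "m \<in> Hom (HC \<B> A B) f f'" and g: "g \<in> Ob (HC \<B> B C)" and X: "X \<in> Ob (PCat P C)"
  shows "inv_arr (PCat P A) (theta P A B C f' g X)
      \<cdot>\<^bsub>PCat P A\<^esub> reidx2 P A C (cmp2 \<B> A B C (Idn (HC \<B> B C) g) m) X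
    = reidx2 P A B m (FOb (reidx P B C g) X) \<cdot>\<^bsub>PCat P A\<^esub> inv_arr (PCat P A) (theta P A B C f g X)"
proof -
  note f = hom1[OF ABC(1,2) m] and gX = reidx_ob[OF ABC(2,3) g X]
  show ?thesis
    by (rule category.inverse_square[OF fib_category[OF ABC(1)] theta_whisker_right[OF assms]
          reidx2_hom[OF ABC(1,3) cmp2_hom[OF ABC m id2_hom[OF ABC(2,3) g]] X]
          theta_hom[OF f(1) g X] theta_hom[OF f(2) g X] reidx2_hom[OF ABC(1,2) m gX]
          theta_inverse[OF f(1) g X] theta_inverse[OF f(2) g X]])
qed

lemma theta_inv_whisker_left:
  assumes f: "f \<in> Ob (HC \<B> A B)" and n: "n \<in> Hom (HC \<B> B C) g g'" and X: "X \<in> Ob (PCat P C)"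
  shows "inv_arr (PCat P A) (theta P A B C f g' X)
      \<cdot>\<^bsub>PCat P A\<^esub> reidx2 P A C (cmp2 \<B> A B C n (Idn (HC \<B> A B) f)) X
    = FArr (reidx P A B f) (reidx2 P B C n X) \<cdot>\<^bsub>PCat P A\<^esub> inv_arr (PCat P A) (theta P A B C f g X)"
proof -
  note g = hom1[OF ABC(2,3) n]
  show ?thesis
    by (rule category.inverse_square[OF fib_category[OF ABC(1)] theta_whisker_left[OF assms]
          reidx2_hom[OF ABC(1,3) cmp2_hom[OF ABC id2_hom[OF ABC(1,2) f] n] X]
          theta_hom[OF f g(1) X] theta_hom[OF f g(2) X]
          reidx_hom[OF ABC(1,2) f reidx2_hom[OF ABC(2,3) n X]]
          theta_inverse[OF f g(1) X] theta_inverse[OF f g(2) X]])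
qed

end

context
  fixes A B f X
  assumes AB: "A \<in> Ob0 \<B>" "B \<in> Ob0 \<B>" and f: "f \<in> Ob (HC \<B> A B)" and X: "X \<in> Ob (PCat P B)"
begin

text \<open>The left unitor of \<open>\<B>\<close> is the right unitor of the dual, so the law comes
  from \<open>p_runit\<close>; \<open>theta_runit\<close> comes from \<open>p_lunit\<close> in the
  same way.\<close>

lemma theta_lunit:
  "reidx2 P A B (LUnit \<B> A B f) X \<cdot>\<^bsub>PCat P A\<^esub> theta P A B B f (Id1 \<B> B) X
     \<cdot>\<^bsub>PCat P A\<^esub> FArr (reidx P A B f) (PUnit P B X)
   = Idn (PCat P A) (FOb (reidx P A B f) X)"
  by (rule pseudofunctor_Cat.p_runit[OF pseudofunctor, unfolded op_bicat_simps, OF AB(2,1) f X])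

lemma theta_runit:
  "reidx2 P A B (RUnit \<B> A B f) X \<cdot>\<^bsub>PCat P A\<^esub> theta P A A B (Id1 \<B> A) f X
     \<cdot>\<^bsub>PCat P A\<^esub> PUnit P A (FOb (reidx P A B f) X)
   = Idn (PCat P A) (FOb (reidx P A B f) X)"
  by (rule pseudofunctor_Cat.p_lunit[OF pseudofunctor, unfolded op_bicat_simps, OF AB(2,1) f X])

text \<open>By \<open>theta_lunit\<close> the image of the unitor is a left inverse of \<theta>
  after \<open>f\<^sup>*\<close> of the unit. Both factors are isomorphisms, so it equals the
  composite of their inverses in the opposite order.\<close>

lemma theta_inv_lunit:
  "reidx2 P A B (LUnit \<B> A B f) X
   = FArr (reidx P A B f) (inv_arr (PCat P B) (PUnit P B X))
     \<cdot>\<^bsub>PCat P A\<^esub> inv_arr (PCat P A) (theta P A B B f (Id1 \<B> B) X)"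
proof -
  interpret category "PCat P A" by (rule fib_category[OF AB(1)])
  note i = id1_ob[OF AB(2)] and F = reidx_hom[OF AB f unit_hom[OF AB(2) X]]
  note T = theta_hom[OF AB AB(2) f i X]
  show ?thesis
    by (rule left_inverse_unique[OF theta_lunit cmp_hom[OF F T]
          reidx2_hom[OF AB lunit_hom[OF AB f] X]
          inverse_arrows_cmp[OF reidx_inverse_arrows[OF AB f unit_inverse[OF AB(2) X]
              unit_hom[OF AB(2) X]] F theta_inverse[OF AB AB(2) f i X] T]])
qed

lemma theta_inv_runit:
  "reidx2 P A B (RUnit \<B> A B f) X
   = inv_arr (PCat P A) (PUnit P A (FOb (reidx P A B f) X))
     \<cdot>\<^bsub>PCat P A\<^esub> inv_arr (PCat P A) (theta P A A B (Id1 \<B> A) f X)"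
proof -
  interpret category "PCat P A" by (rule fib_category[OF AB(1)])
  note i = id1_ob[OF AB(1)] and fX = reidx_ob[OF AB f X]
  note F = unit_hom[OF AB(1) fX] and T = theta_hom[OF AB(1) AB i f X]
  show ?thesis
    by (rule left_inverse_unique[OF theta_runit cmp_hom[OF F T]
          reidx2_hom[OF AB runit_hom[OF AB f] X]
          inverse_arrows_cmp[OF unit_inverse[OF AB(1) fX] F theta_inverse[OF AB(1) AB i f X] T]])
qed

end

context
  fixes A B C D f g h X
  assumes ABCD: "A \<in> Ob0 \<B>" "B \<in> Ob0 \<B>" "C \<in> Ob0 \<B>" "D \<in> Ob0 \<B>"
    and fgh: "f \<in> Ob (HC \<B> A B)" "g \<in> Ob (HC \<B> B C)" "h \<in> Ob (HC \<B> C D)"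
    and X: "X \<in> Ob (PCat P D)"
begin

text \<open>The associator of the dual is the inverse of \<open>Assoc\<close>, so
  \<open>p_assoc\<close> has the image of that inverse on the other side of the equation. Composing
  with the image of \<open>Assoc\<close> moves it across.\<close>

lemma theta_assoc:
  "reidx2 P A D (Assoc \<B> A B C D h g f) X
     \<cdot>\<^bsub>PCat P A\<^esub> theta P A B D f (cmp1 \<B> B C D h g) X
     \<cdot>\<^bsub>PCat P A\<^esub> FArr (reidx P A B f) (theta P B C D g h X)
   = theta P A C D (cmp1 \<B> A B C g f) h X
     \<cdot>\<^bsub>PCat P A\<^esub> theta P A B C f g (FOb (reidx P C D h) X)"
proof -
  interpret category "PCat P A" by (rule fib_category[OF ABCD(1)])
  interpret H: category "HC \<B> A D" by (rule hom_category[OF ABCD(1,4)])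
  let ?a = "Assoc \<B> A B C D h g f"
  note a = assoc_hom[OF ABCD fgh]
  note a' = H.inverse_arrowsD[OF H.inverse_arrows_inv_arr[OF assoc_iso[OF ABCD fgh]] a]
  note gf = cmp1_ob[OF ABCD(1-3) fgh(1,2)] and hg = cmp1_ob[OF ABCD(2-4) fgh(2,3)]
  note hgf = cmp1_ob[OF ABCD(1,3,4) gf fgh(3)] and hX = reidx_ob[OF ABCD(3,4) fgh(3) X]
  note u = theta_hom[OF ABCD(1-3) fgh(1,2) hX] and v = theta_hom[OF ABCD(1,3,4) gf fgh(3) X]
  note La = reidx2_hom[OF ABCD(1,4) a X] and La' = reidx2_hom[OF ABCD(1,4) a'(1) X]
  \<comment> \<open>Vertical functoriality on 2-cells: the composite is the image of an identity
    2-cell.\<close>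
  have "reidx2 P A D ?a X \<cdot>\<^bsub>PCat P A\<^esub> reidx2 P A D (inv_arr (HC \<B> A D) ?a) X
    = Idn (PCat P A) (FOb (reidx P A D (cmp1 \<B> A C D h (cmp1 \<B> A B C g f))) X)"
    using reidx2_cmp[OF ABCD(1,4) a'(1) a X] a'(3) reidx2_id[OF ABCD(1,4) hgf X] by simp
  then show ?thesis
    using pseudofunctor_Cat.p_assoc[OF pseudofunctor, unfolded op_bicat_simps,
        OF ABCD(4,3,2,1) fgh(3,2,1) X, symmetric]
      cmp_assoc[OF cmp_hom[OF u v] La' La] id_left[OF cmp_hom[OF u v]] by simp
qed

text \<open>\<open>theta_assoc\<close> is a square whose parallel sides are the two composites of
  components of \<theta>, with the image of the associator as third side and an identity as fourth.
  Inverting the parallel sides gives the law.\<close>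

lemma theta_inv_assoc:
  "inv_arr (PCat P A) (theta P A B C f g (FOb (reidx P C D h) X))
     \<cdot>\<^bsub>PCat P A\<^esub> inv_arr (PCat P A) (theta P A C D (cmp1 \<B> A B C g f) h X)
     \<cdot>\<^bsub>PCat P A\<^esub> reidx2 P A D (Assoc \<B> A B C D h g f) X
   = FArr (reidx P A B f) (inv_arr (PCat P B) (theta P B C D g h X))
     \<cdot>\<^bsub>PCat P A\<^esub> inv_arr (PCat P A) (theta P A B D f (cmp1 \<B> B C D h g) X)"
proof -
  interpret category "PCat P A" by (rule fib_category[OF ABCD(1)])
  note gf = cmp1_ob[OF ABCD(1-3) fgh(1,2)] and hg = cmp1_ob[OF ABCD(2-4) fgh(2,3)]
  note hX = reidx_ob[OF ABCD(3,4) fgh(3) X] and gh = theta_hom[OF ABCD(2-4) fgh(2,3) X]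
  note a = reidx2_hom[OF ABCD(1,4) assoc_hom[OF ABCD fgh] X]
    and u = theta_hom[OF ABCD(1-3) fgh(1,2) hX] and v = theta_hom[OF ABCD(1,3,4) gf fgh(3) X]
    and p = reidx_hom[OF ABCD(1,2) fgh(1) gh]
    and q = theta_hom[OF ABCD(1,2,4) fgh(1) hg X]
  note u' = theta_inverse[OF ABCD(1-3) fgh(1,2) hX]
    and v' = theta_inverse[OF ABCD(1,3,4) gf fgh(3) X]
    and p' = reidx_inverse_arrows[OF ABCD(1,2) fgh(1) theta_inverse[OF ABCD(2-4) fgh(2,3) X] gh]
    and q' = theta_inverse[OF ABCD(1,2,4) fgh(1) hg X]
  \<comment> \<open>Both composites of \<theta> start at this object; its identity is the fourth
    side of the square.\<close>
  have o: "FOb (reidx P A B f) (FOb (reidx P B C g) (FOb (reidx P C D h) X)) \<in> Ob (PCat P A)"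
    using hom_ob[OF u] by blast
  note sq = inverse_square[OF _ a cmp_hom[OF p q] cmp_hom[OF u v] id_hom[OF o]
      inverse_arrows_cmp[OF p' p q' q] inverse_arrows_cmp[OF u' u v' v]]
  show ?thesis
    using sq theta_assoc id_right[OF cmp_hom[OF u v]]
      cmp_assoc[OF a inverse_arrowsD(1)[OF v' v] inverse_arrowsD(1)[OF u' u]]
      id_left[OF cmp_hom[OF inverse_arrowsD(1)[OF q' q] inverse_arrowsD(1)[OF p' p]]]
    by simp
qed

end

end


section \<open>Optics\<close>

text \<open>Chains may run through steps in either direction, but symmetry and transitivity of the
  target equivalence reduce everything to a single forward step.\<close>

lemma equivclp_map:
  assumes "equivclp r x y" and "\<And>x y. r x y \<Longrightarrow> s (f x) (f y)"
  shows "equivclp s (f x) (f y)"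
  using assms(1)
proof (induction rule: equivclp_induct)
  case (step y z)
  then have "equivclp s (f y) (f z)"
    using assms(2) by (auto intro: r_into_equivclp equivclp_sym)
  with step.IH show ?case
    by (rule equivclp_trans)
qed simp

locale optics = L: indexed \<B> \<L> + R: indexed \<B> \<R>
  for \<B> :: "('o, 'm, 'c) bicat"
    and \<L> :: "('o, 'm, 'c, 'x, 'a) psfun"
    and \<R> :: "('o, 'm, 'c, 'y, 'b) psfun"
begin

abbreviation "obs \<equiv> optic_obs \<B> \<L> \<R>"
abbreviation "reps \<equiv> optic_reps \<B> \<L> \<R>"
abbreviation "step \<equiv> optic_step \<B> \<L> \<R>"
abbreviation "rel \<equiv> optic_rel \<B> \<L> \<R>"
abbreviation "cls \<equiv> optic_class \<B> \<L> \<R>"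
abbreviation "idr \<equiv> id_rep \<B> \<L> \<R>"
abbreviation "cmpr \<equiv> cmp_rep \<B> \<L> \<R>"

lemma id_rep_in_reps:
  assumes "S \<in> obs"
  shows "idr S \<in> reps S S"
  using assms by (auto simp: optic_obs_def L.id1_ob L.unit_hom R.unit_inv_hom)

lemma cmp_rep_in_reps:
  assumes "S \<in> obs" "T \<in> obs" "U \<in> obs" "p \<in> reps S T" "q \<in> reps T U"
  shows "cmpr S T U q p \<in> reps S U"
proof -
  obtain A X X' B Y Y' C Z Z' f l1 r1 g l2 r2 where
    [simp]: "S = (A, X, X')" "T = (B, Y, Y')" "U = (C, Z, Z')" "p = (f, l1, r1)" "q = (g, l2, r2)"
    by (metis prod_cases3)
  have ABC: "A \<in> Ob0 \<B>" "B \<in> Ob0 \<B>" "C \<in> Ob0 \<B>"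
    and Z: "Z \<in> Ob (PCat \<L> C)" "Z' \<in> Ob (PCat \<R> C)"
    and f: "f \<in> Ob (HC \<B> A B)" and g: "g \<in> Ob (HC \<B> B C)"
    and l1: "l1 \<in> Hom (PCat \<L> A) X (FOb (reidx \<L> A B f) Y)"
    and r1: "r1 \<in> Hom (PCat \<R> A) (FOb (reidx \<R> A B f) Y') X'"
    and l2: "l2 \<in> Hom (PCat \<L> B) Y (FOb (reidx \<L> B C g) Z)"
    and r2: "r2 \<in> Hom (PCat \<R> B) (FOb (reidx \<R> B C g) Z') Y'"
    using assms by (auto simp: optic_obs_def)
  interpret LA: category "PCat \<L> A" by (rule L.fib_category[OF ABC(1)])
  interpret RA: category "PCat \<R> A" by (rule R.fib_category[OF ABC(1)])
  show ?thesis
    using L.cmp1_ob[OF ABC f g]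
      LA.cmp_hom[OF LA.cmp_hom[OF l1 L.reidx_hom[OF ABC(1,2) f l2]] L.theta_hom[OF ABC f g Z(1)]]
      RA.cmp_hom[OF RA.cmp_hom[OF R.theta_inv_hom[OF ABC f g Z(2)] R.reidx_hom[OF ABC(1,2) f r2]] r1]
    by simp
qed

text \<open>\<open>optic_rel\<close> asks both ends to be representatives. That \<open>T\<close> is
  an object is what types the components of \<open>\<L>(m)\<close> and \<open>\<R>(m)\<close>
  occurring in the step.\<close>

lemma step_in_reps:
  assumes "S \<in> obs" "T \<in> obs" "step S T p q"
  shows "p \<in> reps S T" "q \<in> reps S T"
proof -
  from assms(3) have "p \<in> reps S T \<and> q \<in> reps S T"
  proof cases
    case (1 m A B f g l X Y r Y' X')
    have AB: "A \<in> Ob0 \<B>" "B \<in> Ob0 \<B>" and Y: "Y \<in> Ob (PCat \<L> B)" "Y' \<in> Ob (PCat \<R> B)"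
      using assms(1,2) 1 by (auto simp: optic_obs_def)
    show ?thesis
      using 1 L.hom1[OF AB 1(5)]
        category.cmp_hom[OF L.fib_category[OF AB(1)] 1(6) L.reidx2_hom[OF AB 1(5) Y(1)]]
        category.cmp_hom[OF R.fib_category[OF AB(1)] R.reidx2_hom[OF AB 1(5) Y(2)] 1(7)]
      by simp
  qed
  then show "p \<in> reps S T" "q \<in> reps S T"
    by auto
qed

section \<open>Composition respects generating steps\<close>

text \<open>If \<open>p\<close> moves along \<open>m : f \<Rightarrow> f'\<close>, the composite
  moves along \<open>m\<close> whiskered with \<open>g\<close>. Whiskering exchanges that 2-cell
  with \<theta>, and naturality of \<open>\<L>(m)\<close> at \<open>l2\<close> then brings
  \<open>\<L>(m)\<close> next to \<open>l\<close>. On the other side the inverse of \<theta>' and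
  naturality of \<open>\<R>(m)\<close> at \<open>r2\<close> do the same.\<close>

lemma step_cmp_right:
  assumes "S \<in> obs" "T \<in> obs" "U \<in> obs" "q \<in> reps T U" "step S T p p'"
  shows "step S U (cmpr S T U q p) (cmpr S T U q p')"
  using assms(5)
proof cases
  case (1 m A B f f' l X Y r Y' X')
  obtain C Z Z' g l2 r2 where [simp]: "U = (C, Z, Z')" "q = (g, l2, r2)"
    by (metis prod_cases3)
  note [simp] = 1(1-4) and m = 1(5) and l = 1(6) and r = 1(7)
  have ABC: "A \<in> Ob0 \<B>" "B \<in> Ob0 \<B>" "C \<in> Ob0 \<B>"
    and Y: "Y \<in> Ob (PCat \<L> B)" "Y' \<in> Ob (PCat \<R> B)"
    and Z: "Z \<in> Ob (PCat \<L> C)" "Z' \<in> Ob (PCat \<R> C)"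
    and g: "g \<in> Ob (HC \<B> B C)"
    and l2: "l2 \<in> Hom (PCat \<L> B) Y (FOb (reidx \<L> B C g) Z)"
    and r2: "r2 \<in> Hom (PCat \<R> B) (FOb (reidx \<R> B C g) Z') Y'"
    using assms by (auto simp: optic_obs_def)
  note f = L.hom1[OF ABC(1,2) m]
  note gZ = L.reidx_ob[OF ABC(2,3) g Z(1)] R.reidx_ob[OF ABC(2,3) g Z(2)]
  interpret LA: category "PCat \<L> A" by (rule L.fib_category[OF ABC(1)])
  interpret RA: category "PCat \<R> A" by (rule R.fib_category[OF ABC(1)])
  let ?m = "cmp2 \<B> A B C (Idn (HC \<B> B C) g) m"
  note m' = L.cmp2_hom[OF ABC m L.id2_hom[OF ABC(2,3) g]]
  note Ll2 = L.reidx_hom[OF ABC(1,2) f(1) l2] L.reidx_hom[OF ABC(1,2) f(2) l2]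
    and Rr2 = R.reidx_hom[OF ABC(1,2) f(1) r2] R.reidx_hom[OF ABC(1,2) f(2) r2]
    and Lm = L.reidx2_hom[OF ABC(1,2) m Y(1)] L.reidx2_hom[OF ABC(1,2) m gZ(1)]
      L.reidx2_hom[OF ABC(1,3) m' Z(1)]
    and Rm = R.reidx2_hom[OF ABC(1,2) m Y(2)] R.reidx2_hom[OF ABC(1,2) m gZ(2)]
      R.reidx2_hom[OF ABC(1,3) m' Z(2)]
    and Lt = L.theta_hom[OF ABC f(1) g Z(1)] L.theta_hom[OF ABC f(2) g Z(1)]
    and Rt = R.theta_inv_hom[OF ABC f(1) g Z(2)] R.theta_inv_hom[OF ABC f(2) g Z(2)]
  note L_hom = LA.cmp_hom[OF LA.cmp_hom[OF l Ll2(1)] Lt(1)]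
    and R_hom = RA.cmp_hom[OF RA.cmp_hom[OF Rt(2) Rr2(2)] r]
  have L_eq: "reidx2 \<L> A C ?m Z \<cdot>\<^bsub>PCat \<L> A\<^esub>
      theta \<L> A B C f g Z \<cdot>\<^bsub>PCat \<L> A\<^esub> FArr (reidx \<L> A B f) l2 \<cdot>\<^bsub>PCat \<L> A\<^esub> l
    = theta \<L> A B C f' g Z \<cdot>\<^bsub>PCat \<L> A\<^esub> FArr (reidx \<L> A B f') l2 \<cdot>\<^bsub>PCat \<L> A\<^esub>
      reidx2 \<L> A B m Y \<cdot>\<^bsub>PCat \<L> A\<^esub> l"
    unfolding LA.cmp_eq_right[OF L.theta_whisker_right[OF ABC m g Z(1)] LA.cmp_hom[OF l Ll2(1)]
        Lt(1) Lm(3) Lm(2) Lt(2)]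
      LA.cmp_eq_right[OF L.reidx2_natural[OF ABC(1,2) m l2] l Ll2(1) Lm(2) Lm(1) Ll2(2)] ..
  have R_eq: "(r \<cdot>\<^bsub>PCat \<R> A\<^esub> FArr (reidx \<R> A B f') r2
        \<cdot>\<^bsub>PCat \<R> A\<^esub> inv_arr (PCat \<R> A) (theta \<R> A B C f' g Z')) \<cdot>\<^bsub>PCat \<R> A\<^esub> reidx2 \<R> A C ?m Z'
    = (r \<cdot>\<^bsub>PCat \<R> A\<^esub> reidx2 \<R> A B m Y') \<cdot>\<^bsub>PCat \<R> A\<^esub>
      FArr (reidx \<R> A B f) r2 \<cdot>\<^bsub>PCat \<R> A\<^esub> inv_arr (PCat \<R> A) (theta \<R> A B C f g Z')"
    using R.theta_inv_whisker_right[OF ABC m g Z(2)]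
      RA.cmp_eq_right[OF R.reidx2_natural[OF ABC(1,2) m r2] Rt(1) Rr2(1) Rm(1,2) Rr2(2)]
      r Rr2 Rm Rt
    by (simp add: Hom_def RA.arr_simps)
  \<comment> \<open>The step rule puts the image of \<open>?m\<close> in front of the left component
    at one end and behind the right component at the other; the two equations recognize these as the
    components of the composites.\<close>
  show ?thesis
    using optic_step.intros[of ?m \<B> A C _ _ _ \<L> X Z _ \<R> Z' X', OF m' L_hom R_hom]
    unfolding L_eq R_eq by simp
qed

text \<open>Here the 2-cell \<open>n\<close> is whiskered with \<open>f\<close> on the other side.
  Its image is carried inside \<open>f\<^sup>*\<close>, so functoriality of \<open>f\<^sup>*\<close>
  takes the place of naturality of the reindexing 2-cell.\<close>

lemma step_cmp_left:
  assumes "S \<in> obs" "T \<in> obs" "U \<in> obs" "p \<in> reps S T" "step T U q q'"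
  shows "step S U (cmpr S T U q p) (cmpr S T U q' p)"
  using assms(5)
proof cases
  case (1 n B C g g' l2 Y Z r2 Z' Y')
  obtain A X X' f l r where [simp]: "S = (A, X, X')" "p = (f, l, r)"
    by (metis prod_cases3)
  note [simp] = 1(1-4) and n = 1(5) and l2 = 1(6) and r2 = 1(7)
  have ABC: "A \<in> Ob0 \<B>" "B \<in> Ob0 \<B>" "C \<in> Ob0 \<B>"
    and Y: "Y \<in> Ob (PCat \<L> B)" "Y' \<in> Ob (PCat \<R> B)"
    and Z: "Z \<in> Ob (PCat \<L> C)" "Z' \<in> Ob (PCat \<R> C)"
    and f: "f \<in> Ob (HC \<B> A B)"
    and l: "l \<in> Hom (PCat \<L> A) X (FOb (reidx \<L> A B f) Y)"
    and r: "r \<in> Hom (PCat \<R> A) (FOb (reidx \<R> A B f) Y') X'"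
    using assms by (auto simp: optic_obs_def)
  note g = L.hom1[OF ABC(2,3) n]
  interpret LA: category "PCat \<L> A" by (rule L.fib_category[OF ABC(1)])
  interpret RA: category "PCat \<R> A" by (rule R.fib_category[OF ABC(1)])
  let ?n = "cmp2 \<B> A B C n (Idn (HC \<B> A B) f)"
  note n' = L.cmp2_hom[OF ABC L.id2_hom[OF ABC(1,2) f] n]
  note Ln = L.reidx2_hom[OF ABC(2,3) n Z(1)] and Rn = R.reidx2_hom[OF ABC(2,3) n Z(2)]
  note L = L.reidx_hom[OF ABC(1,2) f l2] L.reidx_hom[OF ABC(1,2) f Ln]
      L.reidx2_hom[OF ABC(1,3) n' Z(1)]
      L.theta_hom[OF ABC f g(1) Z(1)] L.theta_hom[OF ABC f g(2) Z(1)]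
    and R = R.reidx_hom[OF ABC(1,2) f r2] R.reidx_hom[OF ABC(1,2) f Rn]
      R.reidx2_hom[OF ABC(1,3) n' Z(2)]
      R.theta_inv_hom[OF ABC f g(1) Z(2)] R.theta_inv_hom[OF ABC f g(2) Z(2)]
  note L_hom = LA.cmp_hom[OF LA.cmp_hom[OF l L(1)] L(4)]
    and R_hom = RA.cmp_hom[OF RA.cmp_hom[OF R(5) R(1)] r]
  have L_eq: "reidx2 \<L> A C ?n Z \<cdot>\<^bsub>PCat \<L> A\<^esub>
      theta \<L> A B C f g Z \<cdot>\<^bsub>PCat \<L> A\<^esub> FArr (reidx \<L> A B f) l2 \<cdot>\<^bsub>PCat \<L> A\<^esub> l
    = theta \<L> A B C f g' Z \<cdot>\<^bsub>PCat \<L> A\<^esub>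
      FArr (reidx \<L> A B f) (reidx2 \<L> B C n Z \<cdot>\<^bsub>PCat \<L> B\<^esub> l2) \<cdot>\<^bsub>PCat \<L> A\<^esub> l"
    unfolding L.reidx_cmp[OF ABC(1,2) f l2 Ln] LA.cmp_assoc[OF l L(1,2)]
    by (rule LA.cmp_eq_right[OF L.theta_whisker_left[OF ABC f n Z(1)] LA.cmp_hom[OF l L(1)]
          L(4,3,2,5)])
  have R_eq: "(r \<cdot>\<^bsub>PCat \<R> A\<^esub> FArr (reidx \<R> A B f) r2
        \<cdot>\<^bsub>PCat \<R> A\<^esub> inv_arr (PCat \<R> A) (theta \<R> A B C f g' Z')) \<cdot>\<^bsub>PCat \<R> A\<^esub> reidx2 \<R> A C ?n Z'
    = r \<cdot>\<^bsub>PCat \<R> A\<^esub> FArr (reidx \<R> A B f) (r2 \<cdot>\<^bsub>PCat \<R> B\<^esub> reidx2 \<R> B C n Z')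
      \<cdot>\<^bsub>PCat \<R> A\<^esub> inv_arr (PCat \<R> A) (theta \<R> A B C f g Z')"
    using R.theta_inv_whisker_left[OF ABC f n Z(2)] R.reidx_cmp[OF ABC(1,2) f Rn r2] r R
    by (simp add: Hom_def RA.arr_simps)
  show ?thesis
    using optic_step.intros[of ?n \<B> A C _ _ _ \<L> X Z _ \<R> Z' X', OF n' L_hom R_hom]
    unfolding L_eq R_eq by simp
qed

section \<open>Associativity and unit laws on representatives\<close>

text \<open>A step starts at the codomain of its 2-cell, so the one along the associator leads from
  the bracketing \<open>h \<circ> (g \<circ> f)\<close> to \<open>(h \<circ> g) \<circ> f\<close>.
  Besides coherence, naturality of \<theta> at \<open>l3\<close> and of the inverse of \<theta>' at
  \<open>r3\<close> is needed, since the two bracketings reindex these arrows differently.\<close>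

lemma step_assoc:
  assumes "S \<in> obs" "T \<in> obs" "U \<in> obs" "V \<in> obs"
    "p \<in> reps S T" "q \<in> reps T U" "w \<in> reps U V"
  shows "step S V (cmpr S U V w (cmpr S T U q p)) (cmpr S T V (cmpr T U V w q) p)"
proof -
  obtain A X X' B Y Y' C Z Z' D W W' f l1 r1 g l2 r2 h l3 r3 where
    [simp]: "S = (A, X, X')" "T = (B, Y, Y')" "U = (C, Z, Z')" "V = (D, W, W')"
      "p = (f, l1, r1)" "q = (g, l2, r2)" "w = (h, l3, r3)"
    by (metis prod_cases3)
  have ABCD: "A \<in> Ob0 \<B>" "B \<in> Ob0 \<B>" "C \<in> Ob0 \<B>" "D \<in> Ob0 \<B>"
    and Z: "Z \<in> Ob (PCat \<L> C)" "Z' \<in> Ob (PCat \<R> C)"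
    and W: "W \<in> Ob (PCat \<L> D)" "W' \<in> Ob (PCat \<R> D)"
    and fgh: "f \<in> Ob (HC \<B> A B)" "g \<in> Ob (HC \<B> B C)" "h \<in> Ob (HC \<B> C D)"
    and l1: "l1 \<in> Hom (PCat \<L> A) X (FOb (reidx \<L> A B f) Y)"
    and r1: "r1 \<in> Hom (PCat \<R> A) (FOb (reidx \<R> A B f) Y') X'"
    and l2: "l2 \<in> Hom (PCat \<L> B) Y (FOb (reidx \<L> B C g) Z)"
    and r2: "r2 \<in> Hom (PCat \<R> B) (FOb (reidx \<R> B C g) Z') Y'"
    and l3: "l3 \<in> Hom (PCat \<L> C) Z (FOb (reidx \<L> C D h) W)"
    and r3: "r3 \<in> Hom (PCat \<R> C) (FOb (reidx \<R> C D h) W') Z'"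
    using assms by (auto simp: optic_obs_def)
  interpret LA: category "PCat \<L> A" by (rule L.fib_category[OF ABCD(1)])
  interpret RA: category "PCat \<R> A" by (rule R.fib_category[OF ABCD(1)])
  interpret LB: category "PCat \<L> B" by (rule L.fib_category[OF ABCD(2)])
  interpret RB: category "PCat \<R> B" by (rule R.fib_category[OF ABCD(2)])
  let ?a = "Assoc \<B> A B C D h g f"
  note a = L.assoc_hom[OF ABCD fgh]
  note gf = L.cmp1_ob[OF ABCD(1-3) fgh(1,2)] and hg = L.cmp1_ob[OF ABCD(2-4) fgh(2,3)]
  note hW = L.reidx_ob[OF ABCD(3,4) fgh(3) W(1)] R.reidx_ob[OF ABCD(3,4) fgh(3) W(2)]
  note Lgl3 = L.reidx_hom[OF ABCD(2,3) fgh(2) l3]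
    and Rgr3 = R.reidx_hom[OF ABCD(2,3) fgh(2) r3]
    and Lgh = L.theta_hom[OF ABCD(2-4) fgh(2,3) W(1)]
    and Rgh = R.theta_inv_hom[OF ABCD(2-4) fgh(2,3) W(2)]
  note L = L.reidx_hom[OF ABCD(1,2) fgh(1) l2] L.reidx_hom[OF ABCD(1,2) fgh(1) Lgl3]
      L.reidx_hom[OF ABCD(1,2) fgh(1) Lgh] L.reidx_hom[OF ABCD(1,3) gf l3]
      L.theta_hom[OF ABCD(1-3) fgh(1,2) hW(1)] L.theta_hom[OF ABCD(1-3) fgh(1,2) Z(1)]
      L.theta_hom[OF ABCD(1,3,4) gf fgh(3) W(1)] L.theta_hom[OF ABCD(1,2,4) fgh(1) hg W(1)]
      L.reidx2_hom[OF ABCD(1,4) a W(1)]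
    and R = R.reidx_hom[OF ABCD(1,2) fgh(1) r2] R.reidx_hom[OF ABCD(1,2) fgh(1) Rgr3]
      R.reidx_hom[OF ABCD(1,2) fgh(1) Rgh] R.reidx_hom[OF ABCD(1,3) gf r3]
      R.theta_inv_hom[OF ABCD(1-3) fgh(1,2) hW(2)] R.theta_inv_hom[OF ABCD(1-3) fgh(1,2) Z(2)]
      R.theta_inv_hom[OF ABCD(1,3,4) gf fgh(3) W(2)]
      R.theta_inv_hom[OF ABCD(1,2,4) fgh(1) hg W(2)]
      R.reidx2_hom[OF ABCD(1,4) a W(2)]
  have l: "theta \<L> A B D f (cmp1 \<B> B C D h g) W \<cdot>\<^bsub>PCat \<L> A\<^esub>
      FArr (reidx \<L> A B f) (theta \<L> B C D g h W \<cdot>\<^bsub>PCat \<L> B\<^esub>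
        FArr (reidx \<L> B C g) l3 \<cdot>\<^bsub>PCat \<L> B\<^esub> l2) \<cdot>\<^bsub>PCat \<L> A\<^esub> l1
    \<in> Hom (PCat \<L> A) X (FOb (reidx \<L> A D (cmp1 \<B> A B D (cmp1 \<B> B C D h g) f)) W)"
    by (rule LA.cmp_hom[OF LA.cmp_hom[OF l1 L.reidx_hom[OF ABCD(1,2) fgh(1)
              LB.cmp_hom[OF LB.cmp_hom[OF l2 Lgl3] Lgh]]] L(8)])
  have r: "(r1 \<cdot>\<^bsub>PCat \<R> A\<^esub> FArr (reidx \<R> A B f) r2
        \<cdot>\<^bsub>PCat \<R> A\<^esub> inv_arr (PCat \<R> A) (theta \<R> A B C f g Z'))
      \<cdot>\<^bsub>PCat \<R> A\<^esub> FArr (reidx \<R> A C (cmp1 \<B> A B C g f)) r3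
      \<cdot>\<^bsub>PCat \<R> A\<^esub> inv_arr (PCat \<R> A) (theta \<R> A C D (cmp1 \<B> A B C g f) h W')
    \<in> Hom (PCat \<R> A) (FOb (reidx \<R> A D (cmp1 \<B> A C D h (cmp1 \<B> A B C g f))) W') X'"
    by (rule RA.cmp_hom[OF RA.cmp_hom[OF R(7,4)] RA.cmp_hom[OF RA.cmp_hom[OF R(6,1)] r1]])
  have fL: "FArr (reidx \<L> A B f) (theta \<L> B C D g h W \<cdot>\<^bsub>PCat \<L> B\<^esub>
        FArr (reidx \<L> B C g) l3 \<cdot>\<^bsub>PCat \<L> B\<^esub> l2)
    = FArr (reidx \<L> A B f) (theta \<L> B C D g h W) \<cdot>\<^bsub>PCat \<L> A\<^esub>
      FArr (reidx \<L> A B f) (FArr (reidx \<L> B C g) l3) \<cdot>\<^bsub>PCat \<L> A\<^esub> FArr (reidx \<L> A B f) l2"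
    unfolding L.reidx_cmp[OF ABCD(1,2) fgh(1) LB.cmp_hom[OF l2 Lgl3] Lgh]
      L.reidx_cmp[OF ABCD(1,2) fgh(1) l2 Lgl3] ..
  have fR: "FArr (reidx \<R> A B f) (r2 \<cdot>\<^bsub>PCat \<R> B\<^esub> FArr (reidx \<R> B C g) r3
        \<cdot>\<^bsub>PCat \<R> B\<^esub> inv_arr (PCat \<R> B) (theta \<R> B C D g h W'))
    = FArr (reidx \<R> A B f) r2 \<cdot>\<^bsub>PCat \<R> A\<^esub>
      FArr (reidx \<R> A B f) (FArr (reidx \<R> B C g) r3) \<cdot>\<^bsub>PCat \<R> A\<^esub>
      FArr (reidx \<R> A B f) (inv_arr (PCat \<R> B) (theta \<R> B C D g h W'))"
    unfolding R.reidx_cmp[OF ABCD(1,2) fgh(1) RB.cmp_hom[OF Rgh Rgr3] r2]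
      R.reidx_cmp[OF ABCD(1,2) fgh(1) Rgh Rgr3] ..
  have L_eq: "reidx2 \<L> A D ?a W \<cdot>\<^bsub>PCat \<L> A\<^esub> theta \<L> A B D f (cmp1 \<B> B C D h g) W \<cdot>\<^bsub>PCat \<L> A\<^esub>
      FArr (reidx \<L> A B f) (theta \<L> B C D g h W \<cdot>\<^bsub>PCat \<L> B\<^esub>
        FArr (reidx \<L> B C g) l3 \<cdot>\<^bsub>PCat \<L> B\<^esub> l2) \<cdot>\<^bsub>PCat \<L> A\<^esub> l1
    = theta \<L> A C D (cmp1 \<B> A B C g f) h W \<cdot>\<^bsub>PCat \<L> A\<^esub>
      FArr (reidx \<L> A C (cmp1 \<B> A B C g f)) l3 \<cdot>\<^bsub>PCat \<L> A\<^esub>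
      theta \<L> A B C f g Z \<cdot>\<^bsub>PCat \<L> A\<^esub> FArr (reidx \<L> A B f) l2 \<cdot>\<^bsub>PCat \<L> A\<^esub> l1"
    (is "?lhs = ?rhs")
  proof -
    \<comment> \<open>What remains once \<open>f\<^sup>*\<close> is distributed and the three
      factors of \<open>theta_assoc\<close> are split off.\<close>
    let ?k = "FArr (reidx \<L> A B f) (FArr (reidx \<L> B C g) l3) \<cdot>\<^bsub>PCat \<L> A\<^esub>
      FArr (reidx \<L> A B f) l2 \<cdot>\<^bsub>PCat \<L> A\<^esub> l1"
    have "?lhs = (reidx2 \<L> A D ?a W \<cdot>\<^bsub>PCat \<L> A\<^esub> theta \<L> A B D f (cmp1 \<B> B C D h g) W \<cdot>\<^bsub>PCat \<L> A\<^esub>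
      FArr (reidx \<L> A B f) (theta \<L> B C D g h W)) \<cdot>\<^bsub>PCat \<L> A\<^esub> ?k"
      unfolding fL using l1 L by (simp add: Hom_def LA.arr_simps)
    also have "\<dots> = theta \<L> A C D (cmp1 \<B> A B C g f) h W \<cdot>\<^bsub>PCat \<L> A\<^esub>
      theta \<L> A B C f g (FOb (reidx \<L> C D h) W) \<cdot>\<^bsub>PCat \<L> A\<^esub> ?k"
      unfolding L.theta_assoc[OF ABCD fgh W(1)] using l1 L by (simp add: Hom_def LA.arr_simps)
    also have "\<dots> = ?rhs"
      unfolding LA.cmp_eq_right[OF L.theta_natural[OF ABCD(1-3) fgh(1,2) l3]
          LA.cmp_hom[OF l1 L(1)] L(2,5,6,4)] ..
    finally show ?thesis .
  qed
  have R_eq: "((r1 \<cdot>\<^bsub>PCat \<R> A\<^esub> FArr (reidx \<R> A B f) r2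
        \<cdot>\<^bsub>PCat \<R> A\<^esub> inv_arr (PCat \<R> A) (theta \<R> A B C f g Z'))
      \<cdot>\<^bsub>PCat \<R> A\<^esub> FArr (reidx \<R> A C (cmp1 \<B> A B C g f)) r3
      \<cdot>\<^bsub>PCat \<R> A\<^esub> inv_arr (PCat \<R> A) (theta \<R> A C D (cmp1 \<B> A B C g f) h W'))
      \<cdot>\<^bsub>PCat \<R> A\<^esub> reidx2 \<R> A D ?a W'
    = r1 \<cdot>\<^bsub>PCat \<R> A\<^esub> FArr (reidx \<R> A B f) (r2 \<cdot>\<^bsub>PCat \<R> B\<^esub> FArr (reidx \<R> B C g) r3
        \<cdot>\<^bsub>PCat \<R> B\<^esub> inv_arr (PCat \<R> B) (theta \<R> B C D g h W'))
      \<cdot>\<^bsub>PCat \<R> A\<^esub> inv_arr (PCat \<R> A) (theta \<R> A B D f (cmp1 \<B> B C D h g) W')"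
    (is "?lhs = ?rhs")
  proof -
    \<comment> \<open>Naturality at \<open>r3\<close> moves the inverse of \<theta>' for
      \<open>f\<close> and \<open>g\<close> directly in front of these two factors, which yields one
      side of \<open>theta_inv_assoc\<close>.\<close>
    let ?k = "inv_arr (PCat \<R> A) (theta \<R> A C D (cmp1 \<B> A B C g f) h W')
      \<cdot>\<^bsub>PCat \<R> A\<^esub> reidx2 \<R> A D ?a W'"
    have "?lhs = r1 \<cdot>\<^bsub>PCat \<R> A\<^esub> FArr (reidx \<R> A B f) r2 \<cdot>\<^bsub>PCat \<R> A\<^esub>
        inv_arr (PCat \<R> A) (theta \<R> A B C f g Z') \<cdot>\<^bsub>PCat \<R> A\<^esub>
        FArr (reidx \<R> A C (cmp1 \<B> A B C g f)) r3 \<cdot>\<^bsub>PCat \<R> A\<^esub> ?k"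
      using r1 R by (simp add: Hom_def RA.arr_simps)
    also have "\<dots> = ?rhs"
      unfolding fR RA.cmp_eq_right[OF R.theta_inv_natural[OF ABCD(1-3) fgh(1,2) r3]
          RA.cmp_hom[OF R(9,7)] R(4,6,5,2)] R.theta_inv_assoc[OF ABCD fgh W(2)]
      using r1 R by (simp add: Hom_def RA.arr_simps)
    finally show ?thesis .
  qed
  show ?thesis
    using optic_step.intros[of ?a \<B> A D _ _ _ \<L> X W _ \<R> W' X', OF a l r]
    unfolding L_eq R_eq by simp
qed

text \<open>The left unitor goes from \<open>Id \<circ> f\<close> to \<open>f\<close>, hence the
  step starts at \<open>p\<close>. On the left \<open>theta_lunit\<close> cancels everything but
  \<open>l\<close>; on the right \<open>theta_inv_lunit\<close> already gives the component of the
  composite.\<close>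

lemma step_unit_left:
  assumes "S \<in> obs" "T \<in> obs" "p \<in> reps S T"
  shows "step S T p (cmpr S T T (idr T) p)"
proof -
  obtain A X X' B Y Y' f l r where
    [simp]: "S = (A, X, X')" "T = (B, Y, Y')" "p = (f, l, r)"
    by (metis prod_cases3)
  have AB: "A \<in> Ob0 \<B>" "B \<in> Ob0 \<B>"
    and Y: "Y \<in> Ob (PCat \<L> B)" "Y' \<in> Ob (PCat \<R> B)"
    and f: "f \<in> Ob (HC \<B> A B)"
    and l: "l \<in> Hom (PCat \<L> A) X (FOb (reidx \<L> A B f) Y)"
    and r: "r \<in> Hom (PCat \<R> A) (FOb (reidx \<R> A B f) Y') X'"
    using assms by (auto simp: optic_obs_def)
  interpret LA: category "PCat \<L> A" by (rule L.fib_category[OF AB(1)])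
  let ?u = "LUnit \<B> A B f"
  note u = L.lunit_hom[OF AB f] and i = L.id1_ob[OF AB(2)]
  note L = L.reidx_hom[OF AB f L.unit_hom[OF AB(2) Y(1)]] L.theta_hom[OF AB AB(2) f i Y(1)]
    L.reidx2_hom[OF AB u Y(1)]
  have L_eq: "reidx2 \<L> A B ?u Y \<cdot>\<^bsub>PCat \<L> A\<^esub> theta \<L> A B B f (Id1 \<B> B) Y \<cdot>\<^bsub>PCat \<L> A\<^esub>
      FArr (reidx \<L> A B f) (PUnit \<L> B Y) \<cdot>\<^bsub>PCat \<L> A\<^esub> l = l"
    unfolding LA.cmp_assoc[OF l L(1,2), symmetric]
      LA.cmp_assoc[OF l LA.cmp_hom[OF L(1,2)] L(3), symmetric] L.theta_lunit[OF AB f Y(1)]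
    by (rule LA.id_left[OF l])
  show ?thesis
    using optic_step.intros[of ?u \<B> A B _ _ _ \<L> X Y _ \<R> Y' X',
        OF u LA.cmp_hom[OF LA.cmp_hom[OF l L(1)] L(2)] r]
    unfolding L_eq R.theta_inv_lunit[OF AB f Y(2)] by simp
qed

text \<open>In contrast to the left unit law, the identity now sits at the source, so
  \<open>l\<close> and \<open>r\<close> are reindexed along it. Naturality of the unit and of its
  inverse undoes this before the coherence law applies.\<close>

lemma step_unit_right:
  assumes "S \<in> obs" "T \<in> obs" "p \<in> reps S T"
  shows "step S T p (cmpr S S T p (idr S))"
proof -
  obtain A X X' B Y Y' f l r where
    [simp]: "S = (A, X, X')" "T = (B, Y, Y')" "p = (f, l, r)"
    by (metis prod_cases3)
  have AB: "A \<in> Ob0 \<B>" "B \<in> Ob0 \<B>"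
    and X: "X \<in> Ob (PCat \<L> A)" "X' \<in> Ob (PCat \<R> A)"
    and Y: "Y \<in> Ob (PCat \<L> B)" "Y' \<in> Ob (PCat \<R> B)"
    and f: "f \<in> Ob (HC \<B> A B)"
    and l: "l \<in> Hom (PCat \<L> A) X (FOb (reidx \<L> A B f) Y)"
    and r: "r \<in> Hom (PCat \<R> A) (FOb (reidx \<R> A B f) Y') X'"
    using assms by (auto simp: optic_obs_def)
  interpret LA: category "PCat \<L> A" by (rule L.fib_category[OF AB(1)])
  interpret RA: category "PCat \<R> A" by (rule R.fib_category[OF AB(1)])
  let ?u = "RUnit \<B> A B f"
  note u = L.runit_hom[OF AB f] and i = L.id1_ob[OF AB(1)]
  note fY = L.reidx_ob[OF AB f Y(1)] R.reidx_ob[OF AB f Y(2)]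
  note L = L.unit_hom[OF AB(1) fY(1)] L.theta_hom[OF AB(1) AB i f Y(1)]
      L.reidx2_hom[OF AB u Y(1)]
    and R = R.unit_inv_hom[OF AB(1) fY(2)] R.unit_inv_hom[OF AB(1) X(2)]
      R.theta_inv_hom[OF AB(1) AB i f Y(2)] R.reidx_hom[OF AB(1,1) i r]
  have L_hom: "theta \<L> A A B (Id1 \<B> A) f Y \<cdot>\<^bsub>PCat \<L> A\<^esub> FArr (reidx \<L> A A (Id1 \<B> A)) l
        \<cdot>\<^bsub>PCat \<L> A\<^esub> PUnit \<L> A X
      \<in> Hom (PCat \<L> A) X (FOb (reidx \<L> A B (cmp1 \<B> A A B f (Id1 \<B> A))) Y)"
    by (rule LA.cmp_hom[OF LA.cmp_hom[OF L.unit_hom[OF AB(1) X(1)]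
            L.reidx_hom[OF AB(1,1) i l]] L(2)])
  have L_eq: "reidx2 \<L> A B ?u Y \<cdot>\<^bsub>PCat \<L> A\<^esub> theta \<L> A A B (Id1 \<B> A) f Y \<cdot>\<^bsub>PCat \<L> A\<^esub>
      FArr (reidx \<L> A A (Id1 \<B> A)) l \<cdot>\<^bsub>PCat \<L> A\<^esub> PUnit \<L> A X = l"
    unfolding L.unit_natural[OF AB(1) l, symmetric] LA.cmp_assoc[OF l L(1,2), symmetric]
      LA.cmp_assoc[OF l LA.cmp_hom[OF L(1,2)] L(3), symmetric] L.theta_runit[OF AB f Y(1)]
    by (rule LA.id_left[OF l])
  have R_eq: "r \<cdot>\<^bsub>PCat \<R> A\<^esub> reidx2 \<R> A B ?u Y'
    = inv_arr (PCat \<R> A) (PUnit \<R> A X') \<cdot>\<^bsub>PCat \<R> A\<^esub> FArr (reidx \<R> A A (Id1 \<B> A)) r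
      \<cdot>\<^bsub>PCat \<R> A\<^esub> inv_arr (PCat \<R> A) (theta \<R> A A B (Id1 \<B> A) f Y')"
    unfolding R.theta_inv_runit[OF AB f Y(2)]
    by (rule RA.cmp_eq_right[OF R.unit_inv_natural[OF AB(1) r, symmetric] R(3,1) r R(4,2)])
  show ?thesis
    using optic_step.intros[of ?u \<B> A B _ _ _ \<L> X Y _ \<R> Y' X', OF u L_hom r]
    unfolding L_eq R_eq by simp
qed

section \<open>Passage to equivalence classes\<close>

lemma rel_equiv: "equiv (reps S T) (rel S T)"
  by (auto simp: optic_rel_def intro!: equivI refl_onI symI transI
      intro: equivclp_sym equivclp_trans)

lemma step_rel:
  assumes "S \<in> obs" "T \<in> obs" "step S T p q"
  shows "(p, q) \<in> rel S T"
  using step_in_reps[OF assms] assms(3) by (auto simp: optic_rel_def)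

lemma step_class:
  assumes "S \<in> obs" "T \<in> obs" "step S T p q"
  shows "cls S T p = cls S T q"
  using equiv_class_eq[OF rel_equiv step_rel[OF assms]] by (simp add: optic_class_def)

text \<open>The chain for \<open>p\<close> is mapped with \<open>q\<close> fixed, then the chain for
  \<open>q\<close> with \<open>p'\<close> fixed; the two meet at the composite of \<open>q\<close>
  and \<open>p'\<close>.\<close>

lemma cmp_rel:
  assumes "S \<in> obs" "T \<in> obs" "U \<in> obs" "(p, p') \<in> rel S T" "(q, q') \<in> rel T U"
  shows "(cmpr S T U q p, cmpr S T U q' p') \<in> rel S U"
proof -
  have p: "p \<in> reps S T" "p' \<in> reps S T" "equivclp (step S T) p p'"
    and q: "q \<in> reps T U" "q' \<in> reps T U" "equivclp (step T U) q q'"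
    using assms(4,5) by (auto simp: optic_rel_def)
  have "equivclp (step S U) (cmpr S T U q p) (cmpr S T U q p')"
    by (rule equivclp_map[OF p(3)]) (rule step_cmp_right[OF assms(1-3) q(1)])
  moreover have "equivclp (step S U) (cmpr S T U q p') (cmpr S T U q' p')"
    by (rule equivclp_map[OF q(3), where f = "\<lambda>q. cmpr S T U q p'"])
      (rule step_cmp_left[OF assms(1-3) p(2)])
  ultimately have "equivclp (step S U) (cmpr S T U q p) (cmpr S T U q' p')"
    by (rule equivclp_trans)
  then show ?thesis
    using cmp_rep_in_reps[OF assms(1-3) p(1) q(1)] cmp_rep_in_reps[OF assms(1-3) p(2) q(2)]
    by (simp add: optic_rel_def)
qed

text \<open>By \<open>cmp_rel\<close> all choices of representatives contribute the same class to
  the union, and the union is not empty because \<open>p\<close> and \<open>q\<close> lie in their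
  own classes.\<close>

lemma cmp_class:
  assumes "S \<in> obs" "T \<in> obs" "U \<in> obs" "p \<in> reps S T" "q \<in> reps T U"
  shows "optic_cmp \<B> \<L> \<R> (cls T U q) (cls S T p) = cls S U (cmpr S T U q p)"
proof -
  have eq: "rel S U `` {cmpr S T U q' p'} = rel S U `` {cmpr S T U q p}"
    if "q' \<in> rel T U `` {q}" "p' \<in> rel S T `` {p}" for q' p'
    using equiv_class_eq[OF rel_equiv cmp_rel[OF assms(1-3)]] that by blast
  moreover have "q \<in> rel T U `` {q}" "p \<in> rel S T `` {p}"
    using assms equiv_class_self[OF rel_equiv] by blast+
  ultimately have "(\<Union>q'\<in>rel T U `` {q}. \<Union>p'\<in>rel S T `` {p}. rel S U `` {cmpr S T U q' p'})
    = rel S U `` {cmpr S T U q p}"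
    by blast
  then show ?thesis
    by (simp add: optic_class_def)
qed

text \<open>Presenting every arrow as the class of a representative lets the category axioms be
  reduced to the steps above.\<close>

lemma Hom_Optic:
  "Hom (Optic \<B> \<L> \<R>) S T = {cls S T p |p. S \<in> obs \<and> T \<in> obs \<and> p \<in> reps S T}"
  by (auto simp: Hom_def Optic_def optic_class_def quotient_def)

lemma Optic_simps:
  "Ob (Optic \<B> \<L> \<R>) = obs" "Idn (Optic \<B> \<L> \<R>) S = cls S S (idr S)"
  "Cmp (Optic \<B> \<L> \<R>) = optic_cmp \<B> \<L> \<R>"
  by (simp_all add: Optic_def)

lemma category_Optic: "category (Optic \<B> \<L> \<R>)"
proof
  fix a assume "a \<in> Arr (Optic \<B> \<L> \<R>)"
  then show "Dom (Optic \<B> \<L> \<R>) a \<in> Ob (Optic \<B> \<L> \<R>)" "Cod (Optic \<B> \<L> \<R>) a \<in> Ob (Optic \<B> \<L> \<R>)"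
    by (auto simp: Optic_def)
next
  fix S assume "S \<in> Ob (Optic \<B> \<L> \<R>)"
  then show "Idn (Optic \<B> \<L> \<R>) S \<in> Hom (Optic \<B> \<L> \<R>) S S"
    unfolding Hom_Optic Optic_simps using id_rep_in_reps[of S] by blast
next
  fix a b S T U
  assume "a \<in> Hom (Optic \<B> \<L> \<R>) S T" "b \<in> Hom (Optic \<B> \<L> \<R>) T U"
  then obtain p q where obs: "S \<in> obs" "T \<in> obs" "U \<in> obs"
    and pq: "p \<in> reps S T" "q \<in> reps T U" and ab: "a = cls S T p" "b = cls T U q"
    by (auto simp: Hom_Optic)
  show "b \<cdot>\<^bsub>Optic \<B> \<L> \<R>\<^esub> a \<in> Hom (Optic \<B> \<L> \<R>) S U"
    unfolding ab Hom_Optic Optic_simps cmp_class[OF obs pq]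
    using obs cmp_rep_in_reps[OF obs pq] by blast
next
  fix a S T
  assume "a \<in> Hom (Optic \<B> \<L> \<R>) S T"
  then obtain p where p: "S \<in> obs" "T \<in> obs" "p \<in> reps S T" "a = cls S T p"
    by (auto simp: Hom_Optic)
  show "Idn (Optic \<B> \<L> \<R>) T \<cdot>\<^bsub>Optic \<B> \<L> \<R>\<^esub> a = a"
    unfolding p(4) Optic_simps cmp_class[OF p(1,2,2,3) id_rep_in_reps[OF p(2)]]
    by (rule step_class[OF p(1,2) step_unit_left[OF p(1-3)], symmetric])
  show "a \<cdot>\<^bsub>Optic \<B> \<L> \<R>\<^esub> Idn (Optic \<B> \<L> \<R>) S = a"
    unfolding p(4) Optic_simps cmp_class[OF p(1,1,2) id_rep_in_reps[OF p(1)] p(3)]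
    by (rule step_class[OF p(1,2) step_unit_right[OF p(1-3)], symmetric])
next
  fix a b c S T U V
  assume "a \<in> Hom (Optic \<B> \<L> \<R>) S T" "b \<in> Hom (Optic \<B> \<L> \<R>) T U"
    "c \<in> Hom (Optic \<B> \<L> \<R>) U V"
  then obtain p q w where obs: "S \<in> obs" "T \<in> obs" "U \<in> obs" "V \<in> obs"
    and p: "p \<in> reps S T" "a = cls S T p" and q: "q \<in> reps T U" "b = cls T U q"
    and w: "w \<in> reps U V" "c = cls U V w"
    by (auto simp: Hom_Optic)
  show "(c \<cdot>\<^bsub>Optic \<B> \<L> \<R>\<^esub> b) \<cdot>\<^bsub>Optic \<B> \<L> \<R>\<^esub> a = c \<cdot>\<^bsub>Optic \<B> \<L> \<R>\<^esub> (b \<cdot>\<^bsub>Optic \<B> \<L> \<R>\<^esub> a)"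
    using obs p q w step_class[OF obs(1,4) step_assoc[OF obs p(1) q(1) w(1)]]
    by (simp add: Optic_simps cmp_class cmp_rep_in_reps)
qed

end

text \<open>Composition is defined as a union over representatives; the second conjunct ties it to
  the prescribed formula by evaluating it on any pair of representatives.\<close>

theorem theorem1:
  fixes \<B> :: "('o, 'm, 'c) bicat"
    and \<L> :: "('o, 'm, 'c, 'x, 'a) psfun"
    and \<R> :: "('o, 'm, 'c, 'y, 'b) psfun"
  assumes "bicategory \<B>"
    and "indexed_category \<B> \<L>"
    and "indexed_category \<B> \<R>"
  shows "category (Optic \<B> \<L> \<R>) \<and>
    (\<forall>S\<in>optic_obs \<B> \<L> \<R>. \<forall>T\<in>optic_obs \<B> \<L> \<R>. \<forall>U\<in>optic_obs \<B> \<L> \<R>.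
      \<forall>p\<in>optic_reps \<B> \<L> \<R> S T. \<forall>q\<in>optic_reps \<B> \<L> \<R> T U.
        Cmp (Optic \<B> \<L> \<R>) (optic_class \<B> \<L> \<R> T U q) (optic_class \<B> \<L> \<R> S T p)
          = optic_class \<B> \<L> \<R> S U (cmp_rep \<B> \<L> \<R> S T U q p))"
proof -
  interpret optics \<B> \<L> \<R>
    by (intro optics.intro indexed.intro indexed_axioms.intro assms)
  show ?thesis
    using category_Optic cmp_class by (simp add: Optic_simps)
qed

end
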